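(* The decision problem Extension Globally Minimal Defensive Alliance is solvable in polynomial time when the input graph is a tree.
   Context: Graphs are finite, simple and undirected. For $G=(V,E)$, $X\subseteq V$ and $v\in V$, $\deg_X(v)$ is the number of neighbors of $v$ in $X$, and $\overline{X}=V\setminus X$. A set $A\subseteq V$ is a defensive alliance if $\deg_A(v)+1\ge \deg_{\overline{A}}(v)$ for every $v\in A$. A non-empty defensive alliance is globally minimal if no proper subset of it is a non-empty defensive alliance. Problem Extension Globally Minimal Defensive Alliance. Input: a graph $G=(V,E)$ and sets $U,N\subseteq V$. Question: is there a globally minimal defensive alliance $A\subseteq V\setminus N$ of $G$ with $U\subseteq A$? *)

theory Defs
  imports "HOL-Computational_Algebra.Polynomial"
begin

section \<open>Graphs and defensive alliances\<close>

definition simple_graph :: "'a set \<Rightarrow> 'a set set \<Rightarrow> bool" where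
  "simple_graph V E \<longleftrightarrow> finite V \<and> (\<forall>e\<in>E. e \<subseteq> V \<and> card e = 2)"

definition walk :: "'a set \<Rightarrow> 'a set set \<Rightarrow> 'a list \<Rightarrow> bool" where
  "walk V E xs \<longleftrightarrow> xs \<noteq> [] \<and> set xs \<subseteq> V \<and> successively (\<lambda>u v. {u, v} \<in> E) xs"

definition connected_graph :: "'a set \<Rightarrow> 'a set set \<Rightarrow> bool" where
  "connected_graph V E \<longleftrightarrow>
     V \<noteq> {} \<and> (\<forall>u\<in>V. \<forall>v\<in>V. \<exists>xs. walk V E xs \<and> hd xs = u \<and> last xs = v)"

definition cycle :: "'a set \<Rightarrow> 'a set set \<Rightarrow> 'a list \<Rightarrow> bool" where
  "cycle V E xs \<longleftrightarrow>
     walk V E xs \<and> distinct xs \<and> length xs \<ge> 3 \<and> {last xs, hd xs} \<in> E"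

definition tree :: "'a set \<Rightarrow> 'a set set \<Rightarrow> bool" where
  "tree V E \<longleftrightarrow> simple_graph V E \<and> connected_graph V E \<and> (\<nexists>xs. cycle V E xs)"

definition deg_in :: "'a set set \<Rightarrow> 'a set \<Rightarrow> 'a \<Rightarrow> nat" where
  "deg_in E X v = card {u \<in> X. {u, v} \<in> E}"

definition defensive_alliance :: "'a set \<Rightarrow> 'a set set \<Rightarrow> 'a set \<Rightarrow> bool" where
  "defensive_alliance V E A \<longleftrightarrow>
     A \<subseteq> V \<and> (\<forall>v\<in>A. deg_in E A v + 1 \<ge> deg_in E (V - A) v)"

definition globally_minimal_alliance :: "'a set \<Rightarrow> 'a set set \<Rightarrow> 'a set \<Rightarrow> bool" where
  "globally_minimal_alliance V E A \<longleftrightarrow>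
     A \<noteq> {} \<and> defensive_alliance V E A \<and>
     \<not> (\<exists>B. B \<subset> A \<and> B \<noteq> {} \<and> defensive_alliance V E B)"

definition has_extension :: "'a set \<Rightarrow> 'a set set \<Rightarrow> 'a set \<Rightarrow> 'a set \<Rightarrow> bool" where
  "has_extension V E U N \<longleftrightarrow>
     (\<exists>A. A \<subseteq> V - N \<and> U \<subseteq> A \<and> globally_minimal_alliance V E A)"


section \<open>Random access machines and polynomial time\<close>

text \<open>
  Random access machines in the style of Cook and Reckhow, with a read-only input word over
  \<open>{0, 1}\<close> and a unit charge per executed instruction. The only arithmetic is addition
  and truncated subtraction. There is no multiplication, so apart from loading a constant
  of the program a step at most doubles the largest register content, and the unit-cost measure is polynomially equivalent
  to Turing machine time.

  The registers are indexed by the natural numbers, hold natural numbers, and are initially 0.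
  A machine halts when the program counter leaves the program. It then accepts iff register 0
  is non-zero.
\<close>

datatype instr =
    Const nat nat      \<comment> \<open>\<open>Const r c\<close>: \<open>X r := c\<close>\<close>
  | Add nat nat nat    \<comment> \<open>\<open>Add r i j\<close>: \<open>X r := X i + X j\<close>\<close>
  | Sub nat nat nat    \<comment> \<open>\<open>Sub r i j\<close>: \<open>X r := X i - X j\<close>, truncated at 0\<close>
  | Load nat nat       \<comment> \<open>\<open>Load r i\<close>: \<open>X r := X (X i)\<close>\<close>
  | Store nat nat      \<comment> \<open>\<open>Store i j\<close>: \<open>X (X i) := X j\<close>\<close>
  | Read nat nat       \<comment> \<open>\<open>Read r i\<close>: \<open>X r :=\<close> input symbol at position \<open>X i\<close>\<close>
  | JumpZ nat nat      \<comment> \<open>\<open>JumpZ r k\<close>: if \<open>X r = 0\<close>, go to instruction \<open>k\<close>\<close>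

type_synonym config = "nat \<times> (nat \<Rightarrow> nat)"

text \<open>Positions beyond the end of the input word hold the blank symbol 2.\<close>

definition input_symbol :: "bool list \<Rightarrow> nat \<Rightarrow> nat" where
  "input_symbol w i = (if i < length w then of_bool (w ! i) else 2)"

fun exec :: "bool list \<Rightarrow> instr \<Rightarrow> config \<Rightarrow> config" where
  "exec w (Const r c) (pc, X) = (Suc pc, X(r := c))"
| "exec w (Add r i j) (pc, X) = (Suc pc, X(r := X i + X j))"
| "exec w (Sub r i j) (pc, X) = (Suc pc, X(r := X i - X j))"
| "exec w (Load r i) (pc, X) = (Suc pc, X(r := X (X i)))"
| "exec w (Store i j) (pc, X) = (Suc pc, X(X i := X j))"
| "exec w (Read r i) (pc, X) = (Suc pc, X(r := input_symbol w (X i)))"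
| "exec w (JumpZ r k) (pc, X) = (if X r = 0 then k else Suc pc, X)"

definition step :: "instr list \<Rightarrow> bool list \<Rightarrow> config \<Rightarrow> config" where
  "step P w c = (if fst c < length P then exec w (P ! fst c) c else c)"

definition run :: "instr list \<Rightarrow> bool list \<Rightarrow> nat \<Rightarrow> config" where
  "run P w t = (step P w ^^ t) (0, \<lambda>_. 0)"

text \<open>
  A halted configuration is a fixed point of \<^const>\<open>step\<close>, so \<^term>\<open>halts_within P w t\<close> says
  that at most \<^term>\<open>t\<close> instructions are executed, and \<^term>\<open>snd (run P w t)\<close> is then the
  final register contents.
\<close>

definition halts_within :: "instr list \<Rightarrow> bool list \<Rightarrow> nat \<Rightarrow> bool" where
  "halts_within P w t \<longleftrightarrow> fst (run P w t) \<ge> length P"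

text \<open>
  The language \<open>L\<close> restricted to the inputs in \<open>D\<close> is decidable in polynomial time: one program
  answers every input from \<open>D\<close> correctly within a polynomial number of steps in its length.
\<close>

definition poly_time_solvable_on :: "bool list set \<Rightarrow> bool list set \<Rightarrow> bool" where
  "poly_time_solvable_on D L \<longleftrightarrow>
     (\<exists>(P :: instr list) (p :: nat poly). \<forall>w\<in>D.
        halts_within P w (poly p (length w)) \<and>
        (snd (run P w (poly p (length w))) 0 \<noteq> 0 \<longleftrightarrow> w \<in> L))"


section \<open>The decision problem\<close>

text \<open>
  Input graphs have the vertices \<open>0, \<dots>, n - 1\<close>. An instance is written as \<open>n\<close> in unary, the
  adjacency matrix row by row, and the characteristic vectors of \<open>U\<close> and \<open>N\<close>.
\<close>

definition encode :: "nat \<Rightarrow> nat set set \<Rightarrow> nat set \<Rightarrow> nat set \<Rightarrow> bool list" where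
  "encode n E U N =
     replicate n True @ [False] @
     concat (map (\<lambda>i. map (\<lambda>j. {i, j} \<in> E) [0..<n]) [0..<n]) @
     map (\<lambda>i. i \<in> U) [0..<n] @
     map (\<lambda>i. i \<in> N) [0..<n]"

definition Ext_GM_Def_Alliance :: "bool list set" where
  "Ext_GM_Def_Alliance =
     {encode n E U N | n E U N.
        simple_graph {..<n} E \<and> U \<subseteq> {..<n} \<and> N \<subseteq> {..<n} \<and> has_extension {..<n} E U N}"

definition tree_instances :: "bool list set" where
  "tree_instances =
     {encode n E U N | n E U N. tree {..<n} E \<and> U \<subseteq> {..<n} \<and> N \<subseteq> {..<n}}"

end

theory Submission
  imports Defs
begin

text \<open>
  Write \<open>d\<close> for the degree in the whole graph. A set \<open>A\<close> is a defensive alliance iff each of its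
  vertices has at least \<open>d div 2\<close> neighbours in \<open>A\<close>. In a tree, a nonempty \<open>A\<close> is globally minimal iff
  it is connected and every vertex has exactly \<open>d div 2\<close> neighbours in \<open>A\<close>: if \<open>u \<in> A\<close> had a
  neighbour to spare, then the part of \<open>A\<close> on the \<open>u\<close>-side of any edge \<open>uw\<close> of \<open>A\<close> would be a smaller
  alliance, as \<open>u\<close> is the only vertex on that side adjacent to \<open>w\<close>.

  For a vertex \<open>v\<close> with parent \<open>p\<close>, let the branch be the part of the tree that \<open>v\<close> reaches without
  \<open>p\<close>. Two bits per pair suffice: whether the branch meets \<open>U\<close> (so that \<open>v\<close> is forced), and whether
  \<open>A\<close> can be completed inside the branch. The latter holds iff \<open>v \<notin> N\<close> and some set of exactly
  \<open>d div 2\<close> neighbours contains the parent, all forced children, and only feasible children.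
  Since the branches of the children are smaller, sweeping \<open>n\<close> times over an in-place table of all
  pairs computes all entries, whatever the table contains initially.
\<close>

section \<open>Simple paths and reachability inside a vertex set\<close>

lemma card_Un_if_singleton:
  "S = T \<union> (if P then {v} else {}) \<Longrightarrow> v \<notin> T \<Longrightarrow> finite T \<Longrightarrow> card S = card T + (if P then 1 else 0)"
  by (cases P) auto

text \<open>A new front vertex \<open>a\<close> extends the path; if \<open>a\<close> already lies
  on it, everything before \<open>a\<close> is dropped instead.\<close>

lemma rtranclp_distinct_path:
  assumes "R\<^sup>*\<^sup>* a b"
  shows "\<exists>xs. xs \<noteq> [] \<and> distinct xs \<and> hd xs = a \<and> last xs = b \<and> successively R xs"
  using assms
proof (induction rule: converse_rtranclp_induct)
  case base
  show ?case by (rule exI[of _ "[b]"]) simp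
next
  case (step a y)
  then obtain xs where xs: "xs \<noteq> []" "distinct xs" "hd xs = y" "last xs = b" "successively R xs"
    by blast
  show ?case
  proof (cases "a \<in> set xs")
    case True
    then obtain ys zs where "xs = ys @ a # zs"
      by (meson split_list)
    with xs show ?thesis
      by (intro exI[of _ "a # zs"]) (auto simp: successively_append_iff)
  next
    case False
    with xs step.hyps show ?thesis
      by (intro exI[of _ "a # xs"]) (auto simp: successively_Cons)
  qed
qed

lemma successively_imp_reach:
  "successively R xs \<Longrightarrow> xs \<noteq> [] \<Longrightarrow> R\<^sup>*\<^sup>* (hd xs) (last xs)"
proof (induction xs)
  case (Cons x xs)
  then show ?case
    by (cases xs) (auto intro: converse_rtranclp_into_rtranclp)
qed simp

definition joined :: "'a set set \<Rightarrow> 'a set \<Rightarrow> 'a \<Rightarrow> 'a \<Rightarrow> bool" where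
  "joined E W x y \<longleftrightarrow> x \<in> W \<and> y \<in> W \<and> {x, y} \<in> E"

text \<open>Being reflexive, it relates \<open>x\<close> to itself even outside \<open>W\<close>;
  all longer connections stay inside \<open>W\<close>.\<close>

definition reach :: "'a set set \<Rightarrow> 'a set \<Rightarrow> 'a \<Rightarrow> 'a \<Rightarrow> bool" where
  "reach E W = (joined E W)\<^sup>*\<^sup>*"

lemma reach_refl [simp]: "reach E W x x"
  by (simp add: reach_def)

lemma reach_trans: "reach E W x y \<Longrightarrow> reach E W y z \<Longrightarrow> reach E W x z"
  unfolding reach_def by (rule rtranclp_trans)

lemma reach_joined: "reach E W x y \<Longrightarrow> joined E W y z \<Longrightarrow> reach E W x z"
  unfolding reach_def by (rule rtranclp.rtrancl_into_rtrancl)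

lemma joined_reach: "joined E W x y \<Longrightarrow> reach E W y z \<Longrightarrow> reach E W x z"
  unfolding reach_def by (rule converse_rtranclp_into_rtranclp)

lemma reach_step: "reach E W x y \<Longrightarrow> y \<in> W \<Longrightarrow> z \<in> W \<Longrightarrow> {y, z} \<in> E \<Longrightarrow> reach E W x z"
  by (rule reach_joined) (auto simp: joined_def)

lemma reach_induct [consumes 1, case_names base step]:
  assumes "reach E W x y" "P x"
    "\<And>y z. reach E W x y \<Longrightarrow> joined E W y z \<Longrightarrow> P y \<Longrightarrow> P z"
  shows "P y"
  using assms(1) unfolding reach_def
proof (induction rule: rtranclp_induct)
  case (step y z)
  then show ?case using assms(3)[of y z] by (simp add: reach_def)
qed (rule assms(2))

lemma reach_mono: "reach E W x y \<Longrightarrow> W \<subseteq> W' \<Longrightarrow> reach E W' x y"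
  by (induction rule: reach_induct) (auto simp: joined_def intro: reach_step)

lemma reach_sym: "reach E W x y \<Longrightarrow> reach E W y x"
proof (induction rule: reach_induct)
  case (step y z)
  then have "joined E W z y" by (simp add: joined_def insert_commute)
  then show ?case using step.IH by (rule joined_reach)
qed simp

lemma reach_mem: "reach E W x y \<Longrightarrow> x \<in> W \<Longrightarrow> y \<in> W"
  by (induction rule: reach_induct) (auto simp: joined_def)

section \<open>Minimal alliances in trees\<close>

locale tree_graph =
  fixes V :: "'a set" and E :: "'a set set"
  assumes is_tree: "tree V E"
begin

lemma finite_V: "finite V"
  using is_tree by (auto simp: tree_def simple_graph_def)

lemma edge_in_V: "{u, v} \<in> E \<Longrightarrow> u \<in> V \<and> v \<in> V \<and> u \<noteq> v"
proof -
  assume "{u, v} \<in> E"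
  then have "{u, v} \<subseteq> V" "card {u, v} = 2"
    using is_tree by (auto simp: tree_def simple_graph_def)
  then show ?thesis by (cases "u = v") auto
qed

lemma edge_sym: "{u, v} \<in> E \<longleftrightarrow> {v, u} \<in> E"
  by (simp add: insert_commute)

lemma reach_V:
  assumes "u \<in> V" "v \<in> V"
  shows "reach E V u v"
proof -
  obtain xs where xs: "walk V E xs" "hd xs = u" "last xs = v"
    using is_tree assms unfolding tree_def connected_graph_def by blast
  then have "successively (joined E V) xs"
    unfolding walk_def by (auto simp: joined_def elim!: successively_mono)
  with xs show ?thesis
    by (auto simp: walk_def reach_def dest: successively_imp_reach)
qed

text \<open>A simple path between two neighbours of \<open>v\<close> that avoids \<open>v\<close>
  would close up through \<open>v\<close> to a cycle.\<close>

lemma neighbours_separated: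
  assumes c: "{c, v} \<in> E" and c': "{c', v} \<in> E" and r: "reach E (V - {v}) c c'"
  shows "c = c'"
proof (rule ccontr)
  assume ne: "c \<noteq> c'"
  obtain xs where xs: "xs \<noteq> []" "distinct xs" "hd xs = c" "last xs = c'"
    "successively (joined E (V - {v})) xs"
    using rtranclp_distinct_path[OF r[unfolded reach_def]] by blast
  \<comment> \<open>Every vertex but the last starts a step of \<open>joined\<close>; the last one
    is \<open>c'\<close>, a neighbour of \<open>v\<close>.\<close>
  have "set xs \<subseteq> V - {v}"
  proof
    fix x assume "x \<in> set xs"
    then obtain ys zs where s: "xs = ys @ x # zs" by (meson split_list)
    show "x \<in> V - {v}"
    proof (cases zs)
      case Nil
      with s xs(4) have "x = c'" by simp
      with edge_in_V[OF c'] show ?thesis by auto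
    next
      case (Cons z zs')
      with s xs(5) have "joined E (V - {v}) x z" by (simp add: successively_append_iff)
      then show ?thesis by (simp add: joined_def)
    qed
  qed
  moreover have "successively (\<lambda>u v. {u, v} \<in> E) xs"
    by (rule successively_mono[OF xs(5)]) (auto simp: joined_def)
  \<comment> \<open>Two distinct ends together with \<open>v\<close> give the three vertices that a
    cycle requires.\<close>
  moreover have "length xs \<ge> 2"
    using xs ne by (cases xs; cases "tl xs") auto
  moreover have "{v, c} \<in> E" using c by (simp add: edge_sym)
  ultimately have "cycle V E (v # xs)"
    using xs edge_in_V[OF c] c' by (auto simp: cycle_def walk_def successively_Cons)
  then show False using is_tree by (auto simp: tree_def)
qed

lemma reach_unique_neighbour:
  assumes "{c, v} \<in> E" "{c', v} \<in> E" "reach E (V - {v}) c x" "reach E (V - {v}) c' x"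
  shows "c = c'"
  using assms neighbours_separated reach_sym reach_trans by metis

section \<open>Branches and children of a rooted tree\<close>

definition branch :: "'a \<Rightarrow> 'a \<Rightarrow> 'a set" where
  "branch v p = {u. reach E (V - {p}) v u}"

lemma branch_self: "v \<in> branch v p"
  by (simp add: branch_def)

lemma branch_subset: "v \<in> V \<Longrightarrow> v \<noteq> p \<Longrightarrow> branch v p \<subseteq> V - {p}"
  by (auto simp: branch_def dest: reach_mem)

lemma finite_branch: "v \<in> V \<Longrightarrow> v \<noteq> p \<Longrightarrow> finite (branch v p)"
  using branch_subset finite_V by (meson finite_Diff finite_subset)

text \<open>Deleting a vertex outside \<open>V\<close> deletes nothing, and the tree is
  connected.\<close>

lemma branch_root: "r \<in> V \<Longrightarrow> p \<notin> V \<Longrightarrow> branch r p = V"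
  using branch_subset[of r p] reach_V by (auto simp: branch_def)

lemma branch_neighbour_mem: "{c, v} \<in> E \<Longrightarrow> branch c v \<subseteq> V - {v}"
  using branch_subset edge_in_V by blast

text \<open>\<open>branch c v\<close> is a component of the tree without \<open>v\<close>, so edges
  can leave it only towards \<open>v\<close>.\<close>

lemma branch_edge:
  assumes "{c, v} \<in> E" "x \<in> branch c v" "{x, y} \<in> E" "y \<noteq> v"
  shows "y \<in> branch c v"
proof -
  have "x \<in> V - {v}" using branch_neighbour_mem assms by blast
  then have "joined E (V - {v}) x y" using assms edge_in_V by (auto simp: joined_def)
  with assms(2) show ?thesis by (auto simp: branch_def intro: reach_step reach_joined)
qed

lemma branch_adjacent_root:
  assumes "{c, v} \<in> E" "x \<in> branch c v" "{x, v} \<in> E"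
  shows "x = c"
  using assms neighbours_separated by (auto simp: branch_def)

lemma branch_disjoint:
  assumes "{c, v} \<in> E" "{c', v} \<in> E" "c \<noteq> c'"
  shows "branch c v \<inter> branch c' v = {}"
  using assms reach_unique_neighbour by (auto simp: branch_def)

text \<open>A value \<open>p \<notin> V\<close> encodes that \<open>v\<close> is the root.\<close>

definition rooted :: "'a \<Rightarrow> 'a \<Rightarrow> bool" where
  "rooted v p \<longleftrightarrow> v \<in> V \<and> (p \<notin> V \<or> {v, p} \<in> E)"

definition children :: "'a \<Rightarrow> 'a \<Rightarrow> 'a set" where
  "children v p = {c. {c, v} \<in> E \<and> c \<noteq> p}"

lemma finite_children: "finite (children v p)"
  by (rule finite_subset[OF _ finite_V]) (auto simp: children_def dest: edge_in_V)

lemma rooted_ne: "rooted v p \<Longrightarrow> v \<noteq> p"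
  by (auto simp: rooted_def dest: edge_in_V)

lemma rooted_child: "c \<in> children v p \<Longrightarrow> rooted c v"
  by (auto simp: rooted_def children_def dest: edge_in_V)

text \<open>A path from \<open>c\<close> that avoids \<open>v\<close> is prolonged by the edge from
  \<open>v\<close> to \<open>c\<close>. It cannot hit \<open>p\<close>, for then \<open>c\<close>
  and \<open>p\<close> would be neighbours of \<open>v\<close> joined without
  \<open>v\<close>.\<close>

lemma branch_child_subset:
  assumes "rooted v p" "c \<in> children v p"
  shows "branch c v \<subseteq> branch v p - {v}"
proof
  fix x assume x: "x \<in> branch c v"
  have cv: "{c, v} \<in> E" "c \<noteq> p" using assms by (auto simp: children_def)
  from x have "reach E (V - {v}) c x" by (simp add: branch_def)
  then have "x \<noteq> p \<and> reach E (V - {p}) v x"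
  proof (induction rule: reach_induct)
    case base
    have "joined E (V - {p}) v c"
      using cv edge_in_V[OF cv(1)] rooted_ne[OF assms(1)] by (auto simp: joined_def edge_sym)
    then show ?case using cv joined_reach[OF _ reach_refl] by auto
  next
    case (step y z)
    have "z \<noteq> p"
    proof
      assume "z = p"
      with step.hyps have r: "reach E (V - {v}) c p" by (auto intro: reach_step reach_joined)
      \<comment> \<open>As \<open>p\<close> lies in \<open>V\<close>, \<open>rooted\<close> yields
        the parent edge and not the root case.\<close>
      have "p \<in> V" using step.hyps \<open>z = p\<close> by (auto simp: joined_def)
      then have "{p, v} \<in> E" using assms(1) by (auto simp: rooted_def edge_sym)
      with r cv show False using neighbours_separated by blast
    qed
    then show ?case using step by (auto simp: joined_def intro: reach_step reach_joined)
  qed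
  moreover have "x \<noteq> v" using x branch_neighbour_mem[OF cv(1)] by auto
  ultimately show "x \<in> branch v p - {v}" by (simp add: branch_def)
qed

text \<open>A path from \<open>v\<close> enters the branch of some child, and it can leave that
  branch only through \<open>v\<close>.\<close>

lemma branch_cases:
  assumes "rooted v p" "x \<in> branch v p"
  shows "x = v \<or> (\<exists>c\<in>children v p. x \<in> branch c v)"
proof -
  from assms(2) have "reach E (V - {p}) v x" by (simp add: branch_def)
  then show ?thesis
  proof (induction rule: reach_induct)
    case (step y z)
    show ?case
    proof (cases "z = v")
      case False
      from step.IH show ?thesis
      proof
        assume "y = v"
        with step.hyps have "z \<in> children v p" by (auto simp: children_def joined_def edge_sym)
        then show ?thesis using branch_self by blast
      next
        assume "\<exists>c\<in>children v p. y \<in> branch c v"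
        then obtain c where c: "c \<in> children v p" "y \<in> branch c v" by blast
        have "z \<in> branch c v"
          by (rule branch_edge[OF _ c(2)]) (use c step.hyps False in \<open>auto simp: children_def joined_def\<close>)
        with c show ?thesis by blast
      qed
    qed simp
  qed simp
qed

text \<open>This strict decrease is the measure behind the repeated sweeps over the table.\<close>

lemma card_branch_child:
  assumes "rooted v p" "c \<in> children v p"
  shows "card (branch c v) < card (branch v p)"
proof (rule psubset_card_mono)
  show "finite (branch v p)"
    using assms rooted_ne finite_branch by (auto simp: rooted_def)
  show "branch c v \<subset> branch v p"
    using branch_child_subset[OF assms] branch_self by blast
qed

section \<open>Degree characterisation of minimal alliances\<close>

lemma deg_in_Un: 
  assumes "X \<inter> Y = {}" "finite X" "finite Y"
  shows "deg_in E (X \<union> Y) v = deg_in E X v + deg_in E Y v"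
proof -
  have "{u \<in> X \<union> Y. {u, v} \<in> E} = {u \<in> X. {u, v} \<in> E} \<union> {u \<in> Y. {u, v} \<in> E}" by auto
  then show ?thesis unfolding deg_in_def
    using assms by (subst card_Un_disjoint[symmetric]) auto
qed

lemma alliance_iff:
  assumes "A \<subseteq> V"
  shows "defensive_alliance V E A \<longleftrightarrow> (\<forall>v\<in>A. deg_in E V v div 2 \<le> deg_in E A v)"
proof -
  have "deg_in E V v = deg_in E A v + deg_in E (V - A) v" for v
    using deg_in_Un[of A "V - A" v] assms finite_V finite_subset
    by (metis Diff_disjoint Diff_partition finite_Diff)
  \<comment> \<open>With \<open>a\<close> neighbours inside and \<open>b\<close> outside, both sides
    amount to \<open>a + b < 2 * a + 2\<close>.\<close>
  moreover have "b \<le> a + 1 \<longleftrightarrow> (a + b) div 2 \<le> a" for a b :: nat by linarith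
  ultimately have "deg_in E (V - A) v \<le> deg_in E A v + 1 \<longleftrightarrow> deg_in E V v div 2 \<le> deg_in E A v" for v
    by presburger
  then show ?thesis unfolding defensive_alliance_def using assms by simp
qed

text \<open>Minimality forces connectedness because a component of \<open>A\<close> is an alliance,
  and exact degrees because a spare neighbour allows cutting an edge. Conversely, some edge of
  \<open>A\<close> leaves any nonempty proper subset \<open>B\<close>, and its end in
  \<open>B\<close> falls below the bound.\<close>

lemma globally_minimal_iff:
  assumes "A \<subseteq> V"
  shows "globally_minimal_alliance V E A \<longleftrightarrow>
    A \<noteq> {} \<and> (\<forall>u\<in>A. \<forall>v\<in>A. reach E A u v) \<and> (\<forall>v\<in>A. deg_in E A v = deg_in E V v div 2)"
    (is "?L \<longleftrightarrow> ?R")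
proof
  assume ?L
  then have ne: "A \<noteq> {}" and "defensive_alliance V E A"
    and no: "\<And>B. B \<subset> A \<Longrightarrow> B \<noteq> {} \<Longrightarrow> \<not> defensive_alliance V E B"
    unfolding globally_minimal_alliance_def by auto
  then have al: "\<And>v. v \<in> A \<Longrightarrow> deg_in E V v div 2 \<le> deg_in E A v"
    using alliance_iff[OF assms] by blast
  have minimal: "\<exists>v\<in>B. deg_in E B v < deg_in E V v div 2" if "B \<subset> A" "B \<noteq> {}" for B
    using no[OF that] alliance_iff[of B] that assms by (auto simp: not_le)
  have fin: "finite A" using assms finite_V finite_subset by blast
  have conn: "reach E A u v" if "u \<in> A" "v \<in> A" for u v
  proof (rule ccontr)
    assume n: "\<not> reach E A u v"
    \<comment> \<open>The component of \<open>u\<close> keeps all neighbours in \<open>A\<close> of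
      its vertices.\<close>
    let ?B = "{x. reach E A u x}"
    have "?B \<subset> A" using reach_mem that n by fastforce
    moreover have "u \<in> ?B" by simp
    ultimately obtain x where x: "x \<in> ?B" "deg_in E ?B x < deg_in E V x div 2"
      using minimal by blast
    then have "x \<in> A" using reach_mem that by fastforce
    then have "{y \<in> ?B. {y, x} \<in> E} = {y \<in> A. {y, x} \<in> E}"
      using x(1) reach_mem[OF _ that(1)] by (auto intro: reach_step reach_joined simp: joined_def insert_commute)
    then have "deg_in E ?B x = deg_in E A x" by (simp add: deg_in_def)
    with x al[OF \<open>x \<in> A\<close>] show False by simp
  qed
  have "deg_in E A u = deg_in E V u div 2" if u: "u \<in> A" for u
  proof (rule ccontr)
    assume "deg_in E A u \<noteq> deg_in E V u div 2"
    with al[OF u] have slack: "deg_in E V u div 2 < deg_in E A u" by simp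
    then have "{y \<in> A. {y, u} \<in> E} \<noteq> {}" unfolding deg_in_def by (metis card.empty not_less0)
    then obtain w where w: "w \<in> A" "{w, u} \<in> E" by blast
    have uw: "{u, w} \<in> E" "u \<noteq> w" using w(2) edge_in_V by (auto simp: edge_sym)
    \<comment> \<open>Cut the edge between \<open>u\<close> and \<open>w\<close> and keep the side
      of \<open>u\<close>.\<close>
    let ?B = "A \<inter> branch u w"
    have "w \<notin> branch u w" using branch_neighbour_mem[OF uw(1)] by blast
    then have "?B \<subset> A" "u \<in> ?B" using w u branch_self by auto
    then obtain x where x: "x \<in> ?B" "deg_in E ?B x < deg_in E V x div 2"
      using minimal[of ?B] by blast
    \<comment> \<open>The only neighbour in \<open>A\<close> that a vertex of this side can lose is
      \<open>w\<close>.\<close>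
    have sub: "{y \<in> A. {y, x} \<in> E} - {w} \<subseteq> {y \<in> ?B. {y, x} \<in> E}"
    proof
      fix y assume y: "y \<in> {y \<in> A. {y, x} \<in> E} - {w}"
      then have "{x, y} \<in> E" by (simp add: edge_sym)
      with y x(1) branch_edge[OF uw(1), of x y] show "y \<in> {y \<in> ?B. {y, x} \<in> E}" by simp
    qed
    show False
    \<comment> \<open>The slack of \<open>u\<close> pays for the loss of \<open>w\<close>; no other
      vertex of this side is adjacent to \<open>w\<close>.\<close>
    proof (cases "x = u")
      case True
      have "deg_in E A u - 1 \<le> card ({y \<in> A. {y, u} \<in> E} - {w})"
        unfolding deg_in_def by (simp add: card_Diff_singleton_if)
      also have "\<dots> \<le> deg_in E ?B u"
        unfolding deg_in_def using sub True fin by (intro card_mono) auto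
      finally show False using x(2) slack True by simp
    next
      case False
      then have "{w, x} \<notin> E" using branch_adjacent_root[OF uw(1)] x(1) by (auto simp: edge_sym)
      then have "{y \<in> A. {y, x} \<in> E} \<subseteq> {y \<in> ?B. {y, x} \<in> E}" using sub by auto
      then have "deg_in E A x \<le> deg_in E ?B x"
        unfolding deg_in_def using fin by (intro card_mono) auto
      with x al[of x] show False by simp
    qed
  qed
  with ne conn show ?R by blast
next
  assume R: ?R
  have fin: "finite A" using assms finite_V finite_subset by blast
  have "\<not> defensive_alliance V E B" if B: "B \<subset> A" "B \<noteq> {}" for B
  proof
    assume "defensive_alliance V E B"
    then have al: "\<forall>v\<in>B. deg_in E V v div 2 \<le> deg_in E B v"
      using alliance_iff[of B] B assms by blast
    obtain b a where b: "b \<in> B" "b \<in> A" and a: "a \<in> A" "a \<notin> B" using B by blast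
    have "reach E A b a" using R b a by blast
    then have "\<exists>x y. joined E A x y \<and> x \<in> B \<and> y \<notin> B"
      using b(1) a(2) by (induction rule: reach_induct) blast+
    then obtain x y where xy: "x \<in> B" "y \<notin> B" "y \<in> A" "x \<in> A" "{x, y} \<in> E"
      by (auto simp: joined_def)
    have "deg_in E B x < deg_in E A x" unfolding deg_in_def
      using xy B fin by (intro psubset_card_mono) (auto simp: edge_sym)
    with al xy R show False by fastforce
  qed
  moreover have "defensive_alliance V E A" using R alliance_iff[OF assms] by auto
  ultimately show ?L using R unfolding globally_minimal_alliance_def by blast
qed

end

section \<open>Recursion over the branches\<close>

locale alliance_instance = tree_graph V E for V :: "'a set" and E +
  fixes U N :: "'a set"
begin

text \<open>\<open>q\<close> is 1 if the parent of \<open>v\<close> belongs to the alliance as well, and 0 if \<open>v\<close> has no parent.\<close>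

definition partial_solution :: "'a set \<Rightarrow> 'a \<Rightarrow> nat \<Rightarrow> 'a set \<Rightarrow> bool" where
  "partial_solution B v q A \<longleftrightarrow> A \<subseteq> B \<and> v \<in> A \<and> (\<forall>u\<in>A. reach E A v u) \<and> A \<inter> N = {} \<and> U \<inter> B \<subseteq> A \<and>
     (\<forall>u\<in>A. deg_in E A u + (if u = v then q else 0) = deg_in E V u div 2)"

definition feasible :: "'a \<Rightarrow> 'a \<Rightarrow> bool" where
  "feasible v p \<longleftrightarrow> (\<exists>A. partial_solution (branch v p) v (of_bool ({v, p} \<in> E)) A)"

definition required :: "'a \<Rightarrow> 'a \<Rightarrow> bool" where
  "required v p \<longleftrightarrow> U \<inter> branch v p \<noteq> {}"

text \<open>Any member of the alliance may serve as the root, so all \<open>r\<close> are tried;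
  this also covers an empty \<open>U\<close>, which names no member.\<close>

lemma has_extension_iff:
  assumes "U \<subseteq> V" "p \<notin> V"
  shows "has_extension V E U N \<longleftrightarrow> (\<exists>r\<in>V. feasible r p)"
proof -
  have np: "{r, p} \<notin> E" for r using assms(2) edge_in_V by blast
  have "(\<exists>A. A \<subseteq> V - N \<and> U \<subseteq> A \<and> globally_minimal_alliance V E A) \<longleftrightarrow>
     (\<exists>r\<in>V. \<exists>A. partial_solution V r 0 A)"
  proof
    assume "\<exists>A. A \<subseteq> V - N \<and> U \<subseteq> A \<and> globally_minimal_alliance V E A"
    then obtain A where A: "A \<subseteq> V - N" "U \<subseteq> A" "globally_minimal_alliance V E A" by blast
    then have AV: "A \<subseteq> V" by blast
    obtain r where r: "r \<in> A" using A globally_minimal_iff[OF AV] by blast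
    have "partial_solution V r 0 A"
      using A globally_minimal_iff[OF AV] r unfolding partial_solution_def by auto
    with r AV show "\<exists>r\<in>V. \<exists>A. partial_solution V r 0 A" by blast
  next
    assume "\<exists>r\<in>V. \<exists>A. partial_solution V r 0 A"
    then obtain r A where A: "partial_solution V r 0 A" by blast
    then have AV: "A \<subseteq> V" by (simp add: partial_solution_def)
    have "reach E A u v" if "u \<in> A" "v \<in> A" for u v
      using A that reach_sym reach_trans unfolding partial_solution_def by metis
    then have "globally_minimal_alliance V E A"
      using A globally_minimal_iff[OF AV] unfolding partial_solution_def by auto
    moreover have "A \<subseteq> V - N" "U \<subseteq> A"
      using A assms unfolding partial_solution_def by auto
    ultimately show "\<exists>A. A \<subseteq> V - N \<and> U \<subseteq> A \<and> globally_minimal_alliance V E A" by blast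
  qed
  then show ?thesis
    using np branch_root assms(2) by (simp add: has_extension_def feasible_def)
qed

lemma required_rec:
  assumes "rooted v p"
  shows "required v p \<longleftrightarrow> v \<in> U \<or> (\<exists>c\<in>children v p. required c v)"
  using branch_cases[OF assms] branch_child_subset[OF assms] branch_self
  unfolding required_def by blast

text \<open>Restrict \<open>A\<close> to the branch of \<open>c\<close>. Paths from \<open>v\<close>
  enter it only through \<open>c\<close>, so the restriction is connected and contains
  \<open>c\<close> once it is nonempty. Only \<open>c\<close> loses a neighbour, namely
  \<open>v\<close>, which \<open>q = 1\<close> replaces.\<close>

lemma partial_solution_child:
  assumes rt: "rooted v p" and A: "partial_solution (branch v p) v q A"
    and c: "c \<in> children v p"
  shows "c \<in> A \<Longrightarrow> feasible c v" and "required c v \<Longrightarrow> c \<in> A"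
proof -
  have cv: "{c, v} \<in> E" using c by (simp add: children_def)
  have AB: "A \<subseteq> branch v p" and vA: "v \<in> A" and conn: "\<And>u. u \<in> A \<Longrightarrow> reach E A v u"
    and AN: "A \<inter> N = {}" and UA: "U \<inter> branch v p \<subseteq> A"
    and dg: "\<And>u. u \<in> A \<Longrightarrow> deg_in E A u + (if u = v then q else 0) = deg_in E V u div 2"
    using A by (auto simp: partial_solution_def)
  have fin: "finite A" using AB rt finite_branch rooted_ne finite_subset
    unfolding rooted_def by metis
  let ?A = "A \<inter> branch c v"
  \<comment> \<open>The path may leave the branch through \<open>v\<close> and come back, but it
    re-enters at \<open>c\<close> each time.\<close>
  have key: "u \<in> branch c v \<longrightarrow> c \<in> A \<and> reach E ?A c u" if "reach E A v u" for u
    using that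
  proof (induction rule: reach_induct)
    case base
    then show ?case using branch_neighbour_mem[OF cv] by blast
  next
    case (step y z)
    show ?case
    proof
      assume z: "z \<in> branch c v"
      show "c \<in> A \<and> reach E ?A c z"
      proof (cases "y = v")
        case True
        then have "z = c"
          using branch_adjacent_root[OF cv z] step.hyps by (auto simp: joined_def edge_sym)
        then show ?thesis using step.hyps by (auto simp: joined_def)
      next
        case False
        then have "y \<in> branch c v"
          using branch_edge[OF cv z] step.hyps by (auto simp: joined_def edge_sym)
        with step z show ?thesis by (auto simp: joined_def intro: reach_step reach_joined)
      qed
    qed
  qed
  show "required c v \<Longrightarrow> c \<in> A"
    using UA branch_child_subset[OF rt c] key conn unfolding required_def by blast
  assume cA: "c \<in> A"
  have "deg_in E ?A u + (if u = c then 1 else 0) = deg_in E V u div 2" if u: "u \<in> ?A" for u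
  proof -
    have uv: "u \<noteq> v" using u branch_neighbour_mem[OF cv] by blast
    have "{y \<in> A. {y, u} \<in> E} = {y \<in> ?A. {y, u} \<in> E} \<union> (if u = c then {v} else {})"
    proof -
      have 1: "y \<in> branch c v" if "{y, u} \<in> E" "y \<noteq> v" for y
        using branch_edge[OF cv, of u y] u that by (simp add: edge_sym)
      have 2: "u = c" if "{v, u} \<in> E"
        using branch_adjacent_root[OF cv, of u] u that by (simp add: edge_sym)
      have 3: "{v, c} \<in> E" using cv by (simp add: edge_sym)
      show ?thesis
      proof (rule set_eqI)
        fix y
        have 4: "v \<notin> branch c v" using branch_neighbour_mem[OF cv] by blast
        have 5: "{v, u} \<in> E \<longleftrightarrow> u = c" using 2 3 by blast
        show "y \<in> {y \<in> A. {y, u} \<in> E} \<longleftrightarrow> y \<in> {y \<in> ?A. {y, u} \<in> E} \<union> (if u = c then {v} else {})"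
        proof (cases "y = v")
          case True
          show ?thesis unfolding True using 4 5 vA by simp
        next
          case False
          with 1[of y] show ?thesis by auto
        qed
      qed
    qed
    moreover have "v \<notin> ?A" using branch_neighbour_mem[OF cv] by blast
    ultimately have "deg_in E A u = deg_in E ?A u + (if u = c then 1 else 0)"
      unfolding deg_in_def using fin by (intro card_Un_if_singleton) auto
    with dg[of u] u uv show ?thesis by simp
  qed
  then have "partial_solution (branch c v) c 1 ?A"
    unfolding partial_solution_def using cA branch_self key conn AN UA branch_child_subset[OF rt c]
    by auto
  then show "feasible c v" using cv by (auto simp: feasible_def)
qed

text \<open>Branches of different children are disjoint and not adjacent, so in the union a vertex
  of some \<open>F c\<close> gains at most the neighbour \<open>v\<close>, and only \<open>c\<close>
  itself gains it. Branches of unchosen children contain no vertex of \<open>U\<close>.\<close>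

lemma partial_solution_join:
  assumes rt: "rooted v p" and S: "S \<subseteq> children v p" and vN: "v \<notin> N"
    and f: "\<And>c. c \<in> S \<Longrightarrow> partial_solution (branch c v) c 1 (F c)"
    and req: "\<And>c. c \<in> children v p \<Longrightarrow> required c v \<Longrightarrow> c \<in> S"
    and card: "card S + q = deg_in E V v div 2"
  shows "partial_solution (branch v p) v q (insert v (\<Union>c\<in>S. F c))" (is "partial_solution _ _ _ ?A")
proof -
  have finS: "finite S" using S finite_children finite_subset by blast
  have e: "{c, v} \<in> E" if "c \<in> S" for c using that S by (auto simp: children_def)
  have FB: "F c \<subseteq> branch c v" "c \<in> F c" if "c \<in> S" for c
    using f[OF that] by (auto simp: partial_solution_def)
  have Fv: "v \<notin> F c" if "c \<in> S" for c
    using FB[OF that] branch_neighbour_mem[OF e[OF that]] by blast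
  have sub: "?A \<subseteq> branch v p"
    using FB S branch_child_subset[OF rt] branch_self by blast
  have fin: "finite ?A" using sub rt finite_branch rooted_ne finite_subset
    unfolding rooted_def by metis
  have conn: "reach E ?A v u" if u: "u \<in> ?A" for u
  proof (cases "u = v")
    case False
    then obtain c where c: "c \<in> S" "u \<in> F c" using u by blast
    then have "reach E (F c) c u" using f by (auto simp: partial_solution_def)
    then have r: "reach E ?A c u" using c(1) by (rule_tac reach_mono) auto
    have "joined E ?A v c" using FB[OF c(1)] c e[OF c(1)] by (auto simp: joined_def edge_sym)
    with r show ?thesis by (rule joined_reach[rotated])
  qed simp
  have UA: "U \<inter> branch v p \<subseteq> ?A"
  proof
    fix x assume x: "x \<in> U \<inter> branch v p"
    show "x \<in> ?A"
    proof (cases "x = v")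
      case False
      then obtain c where c: "c \<in> children v p" "x \<in> branch c v"
        using branch_cases[OF rt] x by blast
      then have "required c v" using x by (auto simp: required_def)
      then have "c \<in> S" using req c by blast
      then have "x \<in> F c" using f x c by (auto simp: partial_solution_def)
      with \<open>c \<in> S\<close> show ?thesis by blast
    qed simp
  qed
  have dv: "deg_in E ?A v = card S"
  proof -
    have "{y \<in> ?A. {y, v} \<in> E} = S"
    proof (intro equalityI subsetI)
      fix y assume "y \<in> {y \<in> ?A. {y, v} \<in> E}"
      then have y: "y \<in> ?A" "{y, v} \<in> E" by auto
      have "y \<noteq> v" using y(2) edge_in_V by blast
      then obtain c where c: "c \<in> S" "y \<in> F c" using y by blast
      then have "y = c" using FB[OF c(1)] branch_adjacent_root[OF e[OF c(1)]] y by blast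
      with c show "y \<in> S" by simp
    next
      fix y assume "y \<in> S"
      then show "y \<in> {y \<in> ?A. {y, v} \<in> E}" using FB e by blast
    qed
    then show ?thesis by (simp add: deg_in_def)
  qed
  have dc: "deg_in E ?A u = deg_in E V u div 2" if u: "u \<in> ?A" "u \<noteq> v" for u
  proof -
    obtain c where c: "c \<in> S" "u \<in> F c" using u by blast
    have ub: "u \<in> branch c v" using FB c by blast
    have "{y \<in> ?A. {y, u} \<in> E} = {y \<in> F c. {y, u} \<in> E} \<union> (if u = c then {v} else {})"
    proof (intro equalityI subsetI)
      fix y assume "y \<in> {y \<in> ?A. {y, u} \<in> E}"
      then have y: "y \<in> ?A" "{u, y} \<in> E" by (auto simp: edge_sym)
      show "y \<in> {y \<in> F c. {y, u} \<in> E} \<union> (if u = c then {v} else {})"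
      proof (cases "y = v")
        case True
        then show ?thesis using branch_adjacent_root[OF e[OF c(1)] ub] y by simp
      next
        case False
        then obtain d where d: "d \<in> S" "y \<in> F d" using y by blast
        have "y \<in> branch c v" using branch_edge[OF e[OF c(1)] ub y(2) False] .
        moreover have "y \<in> branch d v" using FB d by blast
        ultimately have "c = d" using branch_disjoint[OF e[OF c(1)] e[OF d(1)]] by blast
        with d y show ?thesis by (auto simp: edge_sym)
      qed
    next
      fix y assume "y \<in> {y \<in> F c. {y, u} \<in> E} \<union> (if u = c then {v} else {})"
      then show "y \<in> {y \<in> ?A. {y, u} \<in> E}"
        using c e[OF c(1)] by (auto simp: edge_sym split: if_splits)
    qed
    moreover have "finite (F c)" using fin c(1) by (auto intro: finite_subset)
    ultimately have "deg_in E ?A u = deg_in E (F c) u + (if u = c then 1 else 0)"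
      unfolding deg_in_def using Fv[OF c(1)] by (intro card_Un_if_singleton) auto
    also have "\<dots> = deg_in E V u div 2" using f[OF c(1)] c(2) by (auto simp: partial_solution_def)
    finally show ?thesis .
  qed
  have "?A \<inter> N = {}" using f vN by (auto simp: partial_solution_def)
  then show ?thesis
    unfolding partial_solution_def using sub conn UA dv dc card by auto
qed

text \<open>The chosen children include the forced ones, are all feasible, and have a prescribed
  number. Such a set exists iff the forced children are feasible and that number lies between the
  two counts.\<close>

lemma feasible_rec:
  assumes rt: "rooted v p"
  shows "feasible v p \<longleftrightarrow> v \<notin> N \<and> (\<forall>c\<in>children v p. required c v \<longrightarrow> feasible c v) \<and>
     card {c \<in> children v p. required c v} + of_bool ({v, p} \<in> E) \<le> deg_in E V v div 2 \<and>
     deg_in E V v div 2 \<le> card {c \<in> children v p. feasible c v} + of_bool ({v, p} \<in> E)"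
    (is "_ \<longleftrightarrow> ?R")
proof
  let ?q = "of_bool ({v, p} \<in> E) :: nat"
  assume "feasible v p"
  then obtain A where A: "partial_solution (branch v p) v ?q A" by (auto simp: feasible_def)
  let ?S = "{c \<in> children v p. c \<in> A}"
  have "{y \<in> A. {y, v} \<in> E} = ?S"
    using A branch_subset[of v p] rt rooted_ne[OF rt]
    by (auto simp: partial_solution_def children_def rooted_def)
  then have "card ?S + ?q = deg_in E V v div 2"
    using A by (auto simp: partial_solution_def deg_in_def)
  moreover have "card {c \<in> children v p. required c v} \<le> card ?S"
    using partial_solution_child(2)[OF rt A] finite_children by (intro card_mono) auto
  moreover have "card ?S \<le> card {c \<in> children v p. feasible c v}"
    using partial_solution_child(1)[OF rt A] finite_children by (intro card_mono) auto
  moreover have "v \<notin> N" using A by (auto simp: partial_solution_def)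
  ultimately show ?R using partial_solution_child[OF rt A] by auto
next
  let ?q = "of_bool ({v, p} \<in> E) :: nat"
  assume R: ?R
  let ?r = "{c \<in> children v p. required c v}" and ?f = "{c \<in> children v p. feasible c v}"
  have sub: "?r \<subseteq> ?f" "finite ?f" using R finite_children by auto
  \<comment> \<open>The lower bound in \<open>?R\<close> also gives
    \<open>?q \<le> deg_in E V v div 2\<close>, so the truncated subtraction is exact.\<close>
  have "card ?r \<le> deg_in E V v div 2 - ?q" "deg_in E V v div 2 - ?q \<le> card ?f" using R by auto
  from exists_subset_between[OF this sub]
  obtain S where S: "?r \<subseteq> S" "S \<subseteq> ?f" "card S = deg_in E V v div 2 - ?q"
    by blast
  have "\<exists>A. partial_solution (branch c v) c 1 A" if "c \<in> S" for c
  proof -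
    have "feasible c v" "{c, v} \<in> E" using that S(2) by (auto simp: children_def)
    then show ?thesis by (simp add: feasible_def)
  qed
  then obtain F where F: "\<And>c. c \<in> S \<Longrightarrow> partial_solution (branch c v) c 1 (F c)" by metis
  have "partial_solution (branch v p) v ?q (insert v (\<Union>c\<in>S. F c))"
    by (rule partial_solution_join[OF rt]) (use R S F in auto)
  then show "feasible v p" by (auto simp: feasible_def)
qed

end

section \<open>Structured programs for random access machines\<close>

datatype com = Block "instr list" | Seq com com (infixr \<open>;;\<close> 60) | Cond nat com com | While nat com

text \<open>\<open>Cond r a b\<close> runs \<open>a\<close> if register \<open>r\<close> is nonzero, and \<open>While r a\<close> loops while it is nonzero.\<close>

fun com_length :: "com \<Rightarrow> nat" where
  "com_length (Block is) = length is"
| "com_length (a ;; b) = com_length a + com_length b"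
| "com_length (Cond r a b) = com_length a + com_length b + 2"
| "com_length (While r a) = com_length a + 2"

text \<open>Jump targets are absolute, so \<open>s\<close> carries the address at which the code
  will be placed.\<close>

fun compile :: "nat \<Rightarrow> com \<Rightarrow> instr list" where
  "compile s (Block is) = is"
| "compile s (a ;; b) = compile s a @ compile (s + com_length a) b"
| "compile s (Cond r a b) =
     JumpZ r (s + com_length a + 2) # compile (s + 1) a @
     JumpZ 2 (s + com_length a + com_length b + 2) # compile (s + com_length a + 2) b"
| "compile s (While r a) = JumpZ r (s + com_length a + 2) # compile (s + 1) a @ [JumpZ 2 s]"

lemma length_compile [simp]: "length (compile s c) = com_length c"
  by (induction c arbitrary: s) auto

fun straight :: "instr \<Rightarrow> bool" where
  "straight (JumpZ r k) = False"
| "straight _ = True"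

text \<open>The value at \<open>JumpZ\<close> is a mere default; the rules for blocks demand
  \<open>straight\<close> instructions.\<close>

fun effect :: "bool list \<Rightarrow> instr \<Rightarrow> (nat \<Rightarrow> nat) \<Rightarrow> nat \<Rightarrow> nat" where
  "effect w (Const r c) X = X(r := c)"
| "effect w (Add r i j) X = X(r := X i + X j)"
| "effect w (Sub r i j) X = X(r := X i - X j)"
| "effect w (Load r i) X = X(r := X (X i))"
| "effect w (Store i j) X = X(X i := X j)"
| "effect w (Read r i) X = X(r := input_symbol w (X i))"
| "effect w (JumpZ r k) X = X"

fun placed :: "instr list \<Rightarrow> nat \<Rightarrow> instr list \<Rightarrow> bool" where
  "placed P s [] \<longleftrightarrow> True"
| "placed P s (i # is) \<longleftrightarrow> s < length P \<and> P ! s = i \<and> placed P (Suc s) is"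

lemma placed_append: "placed P s (xs @ ys) \<longleftrightarrow> placed P s xs \<and> placed P (s + length xs) ys"
  by (induction xs arbitrary: s) auto

lemma placed_suffix: "placed (pre @ xs) (length pre) xs"
proof (induction xs arbitrary: pre)
  case (Cons x xs)
  from Cons[of "pre @ [x]"] show ?case by simp
qed simp

text \<open>Register 2 stays zero throughout, so that \<open>JumpZ 2\<close> is an unconditional jump.\<close>

definition achieves ::
  "bool list \<Rightarrow> com \<Rightarrow> nat \<Rightarrow> ((nat \<Rightarrow> nat) \<Rightarrow> bool) \<Rightarrow> (nat \<Rightarrow> nat) \<Rightarrow> bool" where
  "achieves w c T Q X \<longleftrightarrow> (X 2 = 0 \<longrightarrow> (\<forall>P s. placed P s (compile s c) \<longrightarrow>
     (\<exists>t X'. t \<le> T \<and> (step P w ^^ t) (s, X) = (s + com_length c, X') \<and> X' 2 = 0 \<and> Q X')))"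

section \<open>Timed total correctness rules for compiled code\<close>

lemma achieves_weaken:
  "achieves w c T Q X \<Longrightarrow> T \<le> T' \<Longrightarrow> (\<And>X'. Q X' \<Longrightarrow> Q' X') \<Longrightarrow> achieves w c T' Q' X"
  unfolding achieves_def by (meson le_trans)

lemma step_straight:
  "s < length P \<Longrightarrow> straight (P ! s) \<Longrightarrow> step P w (s, X) = (Suc s, effect w (P ! s) X)"
  by (cases "P ! s") (auto simp: step_def)

lemma steps_straight:
  "placed P s is \<Longrightarrow> list_all straight is \<Longrightarrow>
   (step P w ^^ length is) (s, X) = (s + length is, fold (effect w) is X)"
proof (induction "is" arbitrary: s X)
  case (Cons i "is")
  then have "step P w (s, X) = (Suc s, effect w i X)"
    using step_straight[of s P w X] by auto
  moreover have "(step P w ^^ length is) (Suc s, effect w i X) =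
      (Suc s + length is, fold (effect w) is (effect w i X))"
    by (rule Cons.IH) (use Cons.prems in auto)
  ultimately show ?case by (simp del: funpow.simps add: funpow_Suc_right)
qed simp

lemma achieves_Block:
  assumes "list_all straight is" "length is \<le> T"
    and "fold (effect w) is X 2 = 0 \<and> Q (fold (effect w) is X)"
  shows "achieves w (Block is) T Q X"
  unfolding achieves_def using steps_straight[OF _ assms(1), where w = w and X = X] assms
  by auto

lemma steps_trans:
  "(f ^^ a) x = y \<Longrightarrow> (f ^^ b) y = z \<Longrightarrow> (f ^^ (b + a)) x = z"
  by (simp add: funpow_add)

text \<open>The postcondition of \<open>a\<close> is the correctness of \<open>b\<close> itself, so
  no intermediate assertion has to be supplied.\<close>

lemma achieves_Seq:
  assumes "achieves w a T1 (\<lambda>X'. achieves w b T2 Q X') X" "T1 + T2 \<le> T"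
  shows "achieves w (a ;; b) T Q X"
  unfolding achieves_def
proof (intro impI allI)
  fix P s assume X: "X 2 = 0" and "placed P s (compile s (a ;; b))"
  then have pl: "placed P s (compile s a)" "placed P (s + com_length a) (compile (s + com_length a) b)"
    by (auto simp: placed_append)
  obtain t X' where t: "t \<le> T1" "(step P w ^^ t) (s, X) = (s + com_length a, X')" "X' 2 = 0"
    "achieves w b T2 Q X'"
    using assms(1) X pl(1) unfolding achieves_def[of w a] by blast
  obtain t' X'' where t': "t' \<le> T2"
    "(step P w ^^ t') (s + com_length a, X') = (s + com_length a + com_length b, X'')" "X'' 2 = 0" "Q X''"
    using t(3,4) pl(2) unfolding achieves_def[of w b] by blast
  show "\<exists>t X'. t \<le> T \<and> (step P w ^^ t) (s, X) = (s + com_length (a ;; b), X') \<and> X' 2 = 0 \<and> Q X'"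
    by (rule exI[of _ "t' + t"], rule exI[of _ X''])
      (use t t' steps_trans[OF t(2) t'(2)] assms(2) in \<open>auto simp: add.assoc\<close>)
qed

lemma achieves_SeqI:
  assumes "achieves w a T1 R X" "\<And>X'. X' 2 = 0 \<Longrightarrow> R X' \<Longrightarrow> achieves w b T2 Q X'" "T1 + T2 \<le> T"
  shows "achieves w (a ;; b) T Q X"
proof (rule achieves_Seq[OF achieves_weaken[OF assms(1)] assms(3)])
  fix X' assume "R X'"
  then show "achieves w b T2 Q X'"
    \<comment> \<open>If register 2 is nonzero, \<open>achieves\<close> holds vacuously.\<close>
    using assms(2)[of X'] by (cases "X' 2 = 0") (auto simp: achieves_def)
qed simp

lemma step_JumpZ:
  "s < length P \<Longrightarrow> P ! s = JumpZ r k \<Longrightarrow> step P w (s, X) = (if X r = 0 then k else Suc s, X)"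
  by (simp add: step_def)

lemma achieves_Cond:
  assumes "X r \<noteq> 0 \<Longrightarrow> achieves w a T Q X" "X r = 0 \<Longrightarrow> achieves w b T Q X" "T + 2 \<le> T'"
  shows "achieves w (Cond r a b) T' Q X"
  unfolding achieves_def
proof (intro impI allI)
  fix P s assume X: "X 2 = 0" and pl: "placed P s (compile s (Cond r a b))"
  let ?e = "s + com_length (Cond r a b)"
  have pl: "placed P (Suc s) (compile (Suc s) a)"
    "placed P (s + com_length a + 2) (compile (s + com_length a + 2) b)"
    and j1: "s < length P" "P ! s = JumpZ r (s + com_length a + 2)"
    and j2: "Suc s + com_length a < length P" "P ! (Suc s + com_length a) = JumpZ 2 ?e"
    using pl by (auto simp: placed_append add.assoc)
  show "\<exists>t X'. t \<le> T' \<and> (step P w ^^ t) (s, X) = (?e, X') \<and> X' 2 = 0 \<and> Q X'"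
  proof (cases "X r = 0")
    case True
    obtain t X' where t: "t \<le> T" "(step P w ^^ t) (s + com_length a + 2, X) =
        (s + com_length a + 2 + com_length b, X')" "X' 2 = 0" "Q X'"
      using assms(2)[OF True] X pl(2) unfolding achieves_def by blast
    have "(step P w ^^ 1) (s, X) = (s + com_length a + 2, X)"
      using step_JumpZ[OF j1] True by simp
    from steps_trans[OF this t(2)] show ?thesis
      using t assms(3) by (intro exI[of _ "t + 1"] exI[of _ X']) (auto simp: algebra_simps)
  next
    case False
    obtain t X' where t: "t \<le> T" "(step P w ^^ t) (Suc s, X) = (Suc s + com_length a, X')"
        "X' 2 = 0" "Q X'"
      using assms(1)[OF False] X pl(1) unfolding achieves_def by blast
    have 1: "(step P w ^^ 1) (s, X) = (Suc s, X)"
      using step_JumpZ[OF j1] False by simp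
    have 2: "(step P w ^^ 1) (Suc s + com_length a, X') = (?e, X')"
      using step_JumpZ[OF j2] t(3) by simp
    from steps_trans[OF steps_trans[OF 1 t(2)] 2] show ?thesis
      using t assms(3) by (intro exI[of _ "1 + (t + 1)"] exI[of _ X']) auto
  qed
qed

text \<open>The invariant is indexed by the completed iterations, which fixes their number at
  \<open>m\<close>. Each costs a test and a back jump besides \<open>T\<close>; the final test adds
  1.\<close>

lemma achieves_While:
  assumes "I 0 X"
    and "\<And>j X. j < m \<Longrightarrow> X 2 = 0 \<Longrightarrow> I j X \<Longrightarrow> X r \<noteq> 0 \<and> achieves w a T (I (Suc j)) X"
    and "\<And>X. X 2 = 0 \<Longrightarrow> I m X \<Longrightarrow> X r = 0 \<and> Q X"
    and "m * (T + 2) + 1 \<le> T'"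
  shows "achieves w (While r a) T' Q X"
  unfolding achieves_def
proof (intro impI allI)
  fix P s assume X: "X 2 = 0" and pl: "placed P s (compile s (While r a))"
  let ?e = "s + com_length (While r a)"
  have pl: "placed P (Suc s) (compile (Suc s) a)"
    and j1: "s < length P" "P ! s = JumpZ r ?e"
    and j2: "Suc s + com_length a < length P" "P ! (Suc s + com_length a) = JumpZ 2 s"
    using pl by (auto simp: placed_append)
  have "\<exists>t X'. t \<le> j * (T + 2) \<and> (step P w ^^ t) (s, X) = (s, X') \<and> X' 2 = 0 \<and> I j X'"
    if "j \<le> m" for j
    using that
  proof (induction j)
    case 0
    show ?case by (rule exI[of _ 0]) (use X assms(1) in auto)
  next
    case (Suc j)
    then obtain t X' where t: "t \<le> j * (T + 2)" "(step P w ^^ t) (s, X) = (s, X')" "X' 2 = 0" "I j X'"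
      by auto
    have r: "X' r \<noteq> 0" and "achieves w a T (I (Suc j)) X'"
      using assms(2)[of j X'] t Suc.prems by auto
    then obtain t' X'' where t': "t' \<le> T" "(step P w ^^ t') (Suc s, X') = (Suc s + com_length a, X'')"
      "X'' 2 = 0" "I (Suc j) X''"
      using t(3) pl unfolding achieves_def by blast
    have 1: "(step P w ^^ 1) (s, X') = (Suc s, X')"
      using step_JumpZ[OF j1] r by simp
    have 2: "(step P w ^^ 1) (Suc s + com_length a, X'') = (s, X'')"
      using step_JumpZ[OF j2] t'(3) by simp
    from steps_trans[OF steps_trans[OF steps_trans[OF t(2) 1] t'(2)] 2] show ?case
      using t t' by (intro exI[of _ "1 + (t' + (1 + t))"] exI[of _ X'']) auto
  qed
  then obtain t X' where t: "t \<le> m * (T + 2)" "(step P w ^^ t) (s, X) = (s, X')" "X' 2 = 0" "I m X'"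
    by blast
  then have fin: "X' r = 0" "Q X'" using assms(3) by auto
  have "(step P w ^^ 1) (s, X') = (?e, X')"
    using step_JumpZ[OF j1] fin(1) by simp
  from steps_trans[OF t(2) this]
  show "\<exists>t X'. t \<le> T' \<and> (step P w ^^ t) (s, X) = (?e, X') \<and> X' 2 = 0 \<and> Q X'"
    using t fin assms(4) by (intro exI[of _ "1 + t"] exI[of _ X']) auto
qed

section \<open>Weakest preconditions of loop-free code\<close>

fun loop_free_wp :: "bool list \<Rightarrow> com \<Rightarrow> ((nat \<Rightarrow> nat) \<Rightarrow> bool) \<Rightarrow> (nat \<Rightarrow> nat) \<Rightarrow> bool" where
  "loop_free_wp w (Block is) Q X \<longleftrightarrow>
     list_all straight is \<and> fold (effect w) is X 2 = 0 \<and> Q (fold (effect w) is X)"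
| "loop_free_wp w (a ;; b) Q X \<longleftrightarrow> loop_free_wp w a (loop_free_wp w b Q) X"
| "loop_free_wp w (Cond r a b) Q X \<longleftrightarrow> (if X r = 0 then loop_free_wp w b Q X else loop_free_wp w a Q X)"
| "loop_free_wp w (While r a) Q X \<longleftrightarrow> False"

fun loop_free_time :: "com \<Rightarrow> nat" where
  "loop_free_time (Block is) = length is"
| "loop_free_time (a ;; b) = loop_free_time a + loop_free_time b"
| "loop_free_time (Cond r a b) = max (loop_free_time a) (loop_free_time b) + 2"
| "loop_free_time (While r a) = 0"

text \<open>This reduces correctness to evaluating register updates. Loops have precondition
  \<open>False\<close>, so their time 0 is harmless.\<close>

lemma achieves_loop_free:
  "loop_free_wp w c Q X \<Longrightarrow> loop_free_time c \<le> T \<Longrightarrow> achieves w c T Q X"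
proof (induction c arbitrary: Q X T)
  case (Block "is")
  then show ?case by (intro achieves_Block) auto
next
  case (Seq a b)
  have "achieves w a (loop_free_time a) (loop_free_wp w b Q) X"
    using Seq by simp
  then have "achieves w a (loop_free_time a) (achieves w b (loop_free_time b) Q) X"
    by (rule achieves_weaken) (auto intro: Seq.IH(2))
  then show ?case by (rule achieves_Seq) (use Seq.prems in simp)
next
  case (Cond r a b)
  then show ?case
    by (intro achieves_Cond[of X r w a "max (loop_free_time a) (loop_free_time b)"])
      (auto split: if_splits)
qed simp

lemma achieves_loop_freeI:
  "(X 2 = 0 \<Longrightarrow> loop_free_wp w c Q X) \<Longrightarrow> loop_free_time c \<le> T \<Longrightarrow> achieves w c T Q X"
  using achieves_loop_free[of w c Q X T] by (cases "X 2 = 0") (auto simp: achieves_def)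

lemma achieves_run:
  assumes "achieves w c T Q (\<lambda>_. 0)" "T \<le> t"
  shows "halts_within (compile 0 c) w t \<and> Q (snd (run (compile 0 c) w t))"
proof -
  let ?P = "compile 0 c"
  have "placed ?P 0 ?P" using placed_suffix[of "[]" ?P] by simp
  then obtain t' X' where t': "t' \<le> T" "(step ?P w ^^ t') (0, \<lambda>_. 0) = (com_length c, X')" "Q X'"
    using assms(1) unfolding achieves_def by fastforce
  \<comment> \<open>A halted configuration is a fixed point, so idle steps pad the run to exactly
    \<open>t\<close>.\<close>
  have halt: "(step ?P w ^^ d) (com_length c, X') = (com_length c, X')" for d
    by (induction d) (auto simp: step_def)
  have "run ?P w t = (com_length c, X')"
    unfolding run_def using steps_trans[OF t'(2) halt[of "t - t'"]] t'(1) assms(2) by simp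
  with t'(3) show ?thesis by (simp add: halts_within_def)
qed

section \<open>The program\<close>

text \<open>
  Registers, with the vertex \<open>v\<close>, its parent \<open>p\<close> and the scanned neighbour \<open>c\<close> as loop indices:
  0 answer; 3 the number 1; 4 \<open>n\<close>; 5 \<open>n + 1\<close>; 6 row length \<open>2 n + 2\<close> of the table; 7 sweeps left; 8 address of the
  current cell; 9, 11, 28 input positions of the adjacency row, the \<open>U\<close>-bit and the \<open>N\<close>-bit of \<open>v\<close>;
  10 and 15 addresses of the cells \<open>(0, v)\<close> and \<open>(c, v)\<close>; 12, 14, 18 iterations left over \<open>v\<close>, \<open>p\<close>, \<open>c\<close>;
  13 \<open>p\<close>; 16 input position of the edge bit of \<open>v\<close> and \<open>c\<close>; 17 \<open>c\<close>; 19, 20 lower and upper bound on the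
  number of neighbours in the alliance (the parent counts in both); 21 nonzero iff \<open>v\<close> is forced;
  22 degree of \<open>v\<close>; 23 to 27 scratch; 29, 30 input positions of \<open>U\<close> and \<open>N\<close>; 31 the table address 32.
  The parent \<open>p = n\<close> stands for no parent.
\<close>

definition read_size :: com where
  "read_size = Block [Const 3 1, Read 23 4] ;; While 23 (Block [Add 4 4 3, Read 23 4])"

text \<open>Since register 2 is zero, \<open>Add r i 2\<close> copies register \<open>i\<close>. The
  machine cannot multiply, so \<open>n * n\<close> is accumulated in register 29 by \<open>n\<close>
  additions.\<close>

definition prepare :: com where
  "prepare =
     Block [Add 5 4 3, Add 6 5 5, Const 31 32, Add 29 5 2, Add 7 4 2] ;;
     While 7 (Block [Add 29 29 4, Sub 7 7 3]) ;;
     Block [Add 30 29 4]"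

text \<open>Register 24 becomes the sum of both truncated differences of \<open>c\<close> and
  \<open>p\<close>, which is zero iff \<open>c = p\<close>. The lower entry of a child is nonzero
  iff the child is forced, so it also feeds register 21.\<close>

definition scan_step :: com where
  "scan_step =
     Block [Read 23 16] ;;
     Cond 23
       (Block [Add 22 22 3, Sub 24 17 13, Sub 27 13 17, Add 24 24 27] ;;
        Cond 24
          (Block [Load 25 15, Add 19 19 25, Add 21 21 25, Add 27 15 3, Load 26 27, Add 20 20 26])
          (Block [Add 19 19 3, Add 20 20 3]))
       (Block []) ;;
     Block [Add 15 15 6, Add 16 16 3, Add 17 17 3, Sub 18 18 3]"

definition scan :: com where
  "scan =
     Block [Const 19 0, Const 20 0, Const 21 0, Const 22 0, Const 17 0,
       Add 15 10 2, Add 16 9 2, Add 18 4 2] ;;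
     While 18 scan_step"

text \<open>Register 26 sums the \<open>N\<close>-bit and the truncated excesses of twice the lower
  bound over the degree and of the degree over twice the upper bound plus 1. Subtracting it from 1
  leaves 1 iff all three vanish.\<close>

definition update_cell :: com where
  "update_cell =
     Block [Read 25 11, Add 21 21 25, Read 26 28, Add 24 19 19, Sub 24 24 22, Add 26 26 24,
       Add 24 20 20, Add 24 24 3, Sub 24 22 24, Add 26 26 24, Sub 26 3 26] ;;
     Cond 21 (Cond 26 (Block [Add 25 3 2]) (Block [Add 25 5 2])) (Block [Const 25 0]) ;;
     Block [Store 8 25, Add 8 8 3, Store 8 26, Add 8 8 3, Add 13 13 3, Sub 14 14 3]"

definition row_pass :: com where
  "row_pass =
     Block [Const 13 0, Add 14 5 2] ;; While 14 (scan ;; update_cell) ;;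
     Block [Add 9 9 4, Add 10 10 3, Add 10 10 3, Add 11 11 3, Add 28 28 3, Sub 12 12 3]"

definition table_pass :: com where
  "table_pass =
     Block [Add 8 31 2, Add 9 5 2, Add 10 31 2, Add 11 29 2, Add 28 30 2, Add 12 4 2] ;;
     While 12 row_pass ;; Block [Sub 7 7 3]"

text \<open>Register 15 starts at the upper entry of the pair \<open>(0, n)\<close>, where
  \<open>n\<close> stands for no parent. Register 0 counts the feasible roots.\<close>

definition collect :: com where
  "collect =
     Block [Const 0 0, Add 15 31 4, Add 15 15 4, Add 15 15 3, Add 12 4 2] ;;
     While 12 (Block [Load 25 15, Add 0 0 25, Add 15 15 6, Sub 12 12 3])"

definition solver :: com where
  "solver = read_size ;; prepare ;; Block [Add 7 4 2] ;; While 7 table_pass ;; collect"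

section \<open>Effect and cost of scanning the neighbours and writing one cell\<close>

lemma achieves_scan_step:
  fixes X Y :: "nat \<Rightarrow> nat" and w :: "bool list"
  assumes "X 3 = 1" "X 6 = 2 * n + 2" "28 \<le> b"
    and I: "\<forall>r. r < 15 \<or> 27 < r \<longrightarrow> Y r = X r" "Y 15 = b" "Y 16 = X 9 + j" "Y 17 = j" "Y 18 = n - j"
  defines "a \<equiv> input_symbol w (X 9 + j) \<noteq> 0"
  shows "achieves w scan_step 19 (\<lambda>Y'. (\<forall>r. r < 15 \<or> 27 < r \<longrightarrow> Y' r = X r) \<and>
     Y' 15 = b + (2 * n + 2) \<and> Y' 16 = X 9 + Suc j \<and> Y' 17 = Suc j \<and> Y' 18 = n - Suc j \<and>
     Y' 19 = Y 19 + (if a then if j = X 13 then 1 else X b else 0) \<and>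
     Y' 20 = Y 20 + (if a then if j = X 13 then 1 else X (b + 1) else 0) \<and>
     Y' 21 = Y 21 + (if a then if j = X 13 then 0 else X b else 0) \<and>
     Y' 22 = Y 22 + of_bool a) Y"
proof (rule achieves_loop_freeI)
  assume "Y 2 = 0"
  \<comment> \<open>The scratch registers end at 27, so the scan leaves the table cells from
    \<open>b\<close> on untouched.\<close>
  moreover have "Y b = X b" "Y (Suc b) = X (Suc b)" "27 < b" using assms(3) I(1) by auto
  moreover have "Y 3 = 1" "Y 6 = 2 * n + 2" "Y 13 = X 13" using assms I(1) by auto
  ultimately show "loop_free_wp w scan_step (\<lambda>Y'. (\<forall>r. r < 15 \<or> 27 < r \<longrightarrow> Y' r = X r) \<and>
     Y' 15 = b + (2 * n + 2) \<and> Y' 16 = X 9 + Suc j \<and> Y' 17 = Suc j \<and> Y' 18 = n - Suc j \<and>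
     Y' 19 = Y 19 + (if a then if j = X 13 then 1 else X b else 0) \<and>
     Y' 20 = Y 20 + (if a then if j = X 13 then 1 else X (b + 1) else 0) \<and>
     Y' 21 = Y 21 + (if a then if j = X 13 then 0 else X b else 0) \<and>
     Y' 22 = Y 22 + of_bool a) Y"
    using I unfolding scan_step_def a_def by auto
qed (simp add: scan_step_def)

lemma achieves_scan:
  fixes X :: "nat \<Rightarrow> nat" and w :: "bool list"
  assumes "X 3 = 1" "X 4 = n" "X 6 = 2 * n + 2" "28 \<le> X 10"
  defines "a \<equiv> \<lambda>c. input_symbol w (X 9 + c) \<noteq> 0" and "b \<equiv> \<lambda>c. X 10 + c * (2 * n + 2)"
  shows "achieves w scan (21 * n + 9) (\<lambda>Y. (\<forall>r. r < 15 \<or> 27 < r \<longrightarrow> Y r = X r) \<and>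
     Y 19 = (\<Sum>c<n. if a c then if c = X 13 then 1 else X (b c) else 0) \<and>
     Y 20 = (\<Sum>c<n. if a c then if c = X 13 then 1 else X (b c + 1) else 0) \<and>
     Y 21 = (\<Sum>c<n. if a c then if c = X 13 then 0 else X (b c) else 0) \<and>
     Y 22 = (\<Sum>c<n. of_bool (a c))) X" (is "achieves w scan _ ?Q X")
proof -
  define I where "I j Y \<longleftrightarrow> (\<forall>r. r < 15 \<or> 27 < r \<longrightarrow> Y r = X r) \<and>
     Y 15 = b j \<and> Y 16 = X 9 + j \<and> Y 17 = j \<and> Y 18 = n - j \<and>
     Y 19 = (\<Sum>c<j. if a c then if c = X 13 then 1 else X (b c) else 0) \<and>
     Y 20 = (\<Sum>c<j. if a c then if c = X 13 then 1 else X (b c + 1) else 0) \<and>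
     Y 21 = (\<Sum>c<j. if a c then if c = X 13 then 0 else X (b c) else 0) \<and>
     Y 22 = (\<Sum>c<j. of_bool (a c))" for j Y
  show ?thesis
    unfolding scan_def
  proof (rule achieves_SeqI[where R = "I 0"])
    show "achieves w (Block [Const 19 0, Const 20 0, Const 21 0, Const 22 0, Const 17 0,
       Add 15 10 2, Add 16 9 2, Add 18 4 2]) 8 (I 0) X"
      by (rule achieves_loop_freeI) (use assms in \<open>auto simp: I_def b_def\<close>)
    show "achieves w (While 18 scan_step) (21 * n + 1) ?Q Y" if "I 0 Y" for Y
    proof (rule achieves_While[where I = I and m = n and T = 19])
      fix j Z assume j: "j < n" and "I j Z"
      then have Z: "\<forall>r. r < 15 \<or> 27 < r \<longrightarrow> Z r = X r" "Z 15 = b j" "Z 16 = X 9 + j" "Z 17 = j" "Z 18 = n - j"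
        "Z 19 = (\<Sum>c<j. if a c then if c = X 13 then 1 else X (b c) else 0)"
        "Z 20 = (\<Sum>c<j. if a c then if c = X 13 then 1 else X (b c + 1) else 0)"
        "Z 21 = (\<Sum>c<j. if a c then if c = X 13 then 0 else X (b c) else 0)"
        "Z 22 = (\<Sum>c<j. of_bool (a c))"
        unfolding I_def by blast+
      have "28 \<le> b j" using assms(4) by (simp add: b_def)
      have aj: "input_symbol w (X 9 + j) \<noteq> 0 \<longleftrightarrow> a j" by (simp add: a_def)
      have S: "b (Suc j) = b j + (2 * n + 2)" by (simp add: b_def)
      from achieves_scan_step[OF assms(1,3) \<open>28 \<le> b j\<close> Z(1-5), where w = w, unfolded aj]
      have "achieves w scan_step 19 (I (Suc j)) Z"
        by (rule achieves_weaken) (auto simp: I_def S Z(6-9))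
      then show "Z 18 \<noteq> 0 \<and> achieves w scan_step 19 (I (Suc j)) Z" using Z(5) j by simp
    qed (use that in \<open>auto simp: I_def\<close>)
  qed simp
qed

lemma achieves_update_cell:
  fixes X :: "nat \<Rightarrow> nat" and w :: "bool list"
  assumes "X 3 = 1" "X 5 = n + 1" "32 \<le> X 8"
  defines "ok \<equiv> input_symbol w (X 28) = 0 \<and> 2 * X 19 \<le> X 22 \<and> X 22 \<le> 2 * X 20 + 1"
    and "req \<equiv> X 21 + input_symbol w (X 11) \<noteq> 0"
  shows "achieves w update_cell 22 (\<lambda>Y.
     (\<forall>r. r \<notin> {8, 13, 14} \<and> (r < 15 \<or> 27 < r) \<and> r \<noteq> X 8 \<and> r \<noteq> X 8 + 1 \<longrightarrow> Y r = X r) \<and>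
     Y 8 = X 8 + 2 \<and> Y 13 = Suc (X 13) \<and> Y 14 = X 14 - 1 \<and>
     Y (X 8) = (if req then if ok then 1 else n + 1 else 0) \<and> Y (X 8 + 1) = of_bool ok) X"
proof (rule achieves_loop_freeI)
  assume X2: "X 2 = 0"
  have s: "2 * X 19 - X 22 = 0 \<longleftrightarrow> 2 * X 19 \<le> X 22"
    "X 22 - Suc (2 * X 20) = 0 \<longleftrightarrow> X 22 \<le> Suc (2 * X 20)" by auto
  show "loop_free_wp w update_cell (\<lambda>Y.
     (\<forall>r. r \<notin> {8, 13, 14} \<and> (r < 15 \<or> 27 < r) \<and> r \<noteq> X 8 \<and> r \<noteq> X 8 + 1 \<longrightarrow> Y r = X r) \<and>
     Y 8 = X 8 + 2 \<and> Y 13 = Suc (X 13) \<and> Y 14 = X 14 - 1 \<and>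
     Y (X 8) = (if req then if ok then 1 else n + 1 else 0) \<and> Y (X 8 + 1) = of_bool ok) X"
    using assms(1-3) X2 unfolding update_cell_def ok_def req_def
    by (auto simp flip: mult_2)
qed (simp add: update_cell_def)

section \<open>Input words\<close>

lemma concat_map_upt_nth:
  "length (concat (map (\<lambda>i. map (f i) [0..<n]) [0..<m])) = m * n"
  "i < m \<Longrightarrow> j < n \<Longrightarrow> concat (map (\<lambda>i. map (f i) [0..<n]) [0..<m]) ! (i * n + j) = f i j"
proof (induction m)
  case (Suc m)
  { case 1 show ?case using Suc(1) by simp }
  case 2
  show ?case
  proof (cases "i = m")
    case True
    then show ?thesis using Suc(1) 2 by (simp add: nth_append)
  next
    case False
    then have "i < m" using 2 by simp
    then have "Suc i * n \<le> m * n" by (intro mult_le_mono1) simp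
    then have "i * n + j < m * n" using 2 by simp
    then show ?thesis using Suc 2 \<open>i < m\<close> by (simp add: nth_append)
  qed
qed auto

lemma length_encode: "length (encode n E U N) = n + 1 + n * n + n + n"
  by (simp add: encode_def concat_map_upt_nth)

lemma index_less_square: "i < n \<Longrightarrow> j < n \<Longrightarrow> i * n + j < n * (n :: nat)"
proof -
  assume "i < n" "j < n"
  then have "Suc i * n \<le> n * n" by (intro mult_le_mono1) simp
  with \<open>j < n\<close> show ?thesis by simp
qed

lemma input_symbol_append:
  "input_symbol (xs @ ys) i = (if i < length xs then of_bool (xs ! i) else input_symbol ys (i - length xs))"
  by (auto simp: input_symbol_def nth_append)

lemma input_symbol_Cons:
  "input_symbol (x # xs) i = (if i = 0 then of_bool x else input_symbol xs (i - 1))"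
  using input_symbol_append[of "[x]" xs i] by simp

lemma input_symbol_map_upt: "i < n \<Longrightarrow> input_symbol (map f [0..<n]) i = of_bool (f i)"
  by (simp add: input_symbol_def)

lemma input_symbol_size: "i < n \<Longrightarrow> input_symbol (encode n E U N) i = 1"
  "input_symbol (encode n E U N) n = 0"
  by (auto simp: encode_def input_symbol_append input_symbol_Cons)

lemma input_symbol_edge:
  "i < n \<Longrightarrow> j < n \<Longrightarrow> input_symbol (encode n E U N) (n + 1 + i * n + j) = of_bool ({i, j} \<in> E)"
  using index_less_square[of i n j]
  by (auto simp: encode_def input_symbol_append input_symbol_Cons concat_map_upt_nth)

lemma input_symbol_U:
  "i < n \<Longrightarrow> input_symbol (encode n E U N) (n + 1 + n * n + i) = of_bool (i \<in> U)"
  by (auto simp: encode_def input_symbol_append input_symbol_Cons concat_map_upt_nth)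

lemma input_symbol_N:
  "i < n \<Longrightarrow> input_symbol (encode n E U N) (n + 1 + n * n + n + i) = of_bool (i \<in> N)"
  by (auto simp: encode_def input_symbol_append input_symbol_Cons concat_map_upt_nth input_symbol_map_upt)

text \<open>The first 0 symbol marks the end of the unary prefix and so determines \<open>n\<close>;
  the other symbols are then read off bit by bit.\<close>

lemma encode_inject:
  assumes "encode n E U N = encode n' E' U' N'"
    and "simple_graph {..<n} E" "U \<subseteq> {..<n}" "N \<subseteq> {..<n}"
    and "simple_graph {..<n'} E'" "U' \<subseteq> {..<n'}" "N' \<subseteq> {..<n'}"
  shows "n = n' \<and> E = E' \<and> U = U' \<and> N = N'"
proof -
  let ?w = "encode n E U N"
  have n: "n = n'"
  proof (rule linorder_cases)
    assume "n < n'"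
    then show ?thesis using input_symbol_size(1)[of n n' E' U' N'] input_symbol_size(2)[of n E U N] assms(1) by simp
  next
    assume "n' < n"
    then show ?thesis using input_symbol_size(1)[of n' n E U N] input_symbol_size(2)[of n' E' U' N'] assms(1) by simp
  qed
  note eq = assms(1)[folded n]
  have e: "{i, j} \<in> E \<longleftrightarrow> {i, j} \<in> E'" if "i < n" "j < n" for i j
    using input_symbol_edge[OF that, of E U N] input_symbol_edge[OF that, of E' U' N', folded eq] by (simp only: of_bool_eq_iff)
  have edge: "\<exists>i j. x = {i, j} \<and> i < n \<and> j < n" if "x \<in> E \<union> E'" for x
  proof -
    have "x \<subseteq> {..<n}" "card x = 2" using that assms(2,5) n by (auto simp: simple_graph_def)
    then show ?thesis by (auto simp: card_2_iff)
  qed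
  have "E = E'" using e edge by blast
  moreover have "i \<in> U \<longleftrightarrow> i \<in> U'" if "i < n" for i
    using input_symbol_U[OF that, of E U N] input_symbol_U[OF that, of E' U' N', folded eq] by (simp only: of_bool_eq_iff)
  moreover have "i \<in> N \<longleftrightarrow> i \<in> N'" if "i < n" for i
    using input_symbol_N[OF that, of E U N] input_symbol_N[OF that, of E' U' N', folded eq] by (simp only: of_bool_eq_iff)
  ultimately show ?thesis using n assms by blast
qed

section \<open>Correctness and running time\<close>

context alliance_instance
begin

section \<open>Table values and their recurrences\<close>

definition upper_value :: "'a \<Rightarrow> 'a \<Rightarrow> nat" where
  "upper_value v p = of_bool (feasible v p)"

text \<open>
  A child that is forced but infeasible must make its parent infeasible. The value \<open>card V + 1\<close>
  pushes the lower bound above every degree.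
\<close>

definition lower_value :: "'a \<Rightarrow> 'a \<Rightarrow> nat" where
  "lower_value v p = (if required v p then if feasible v p then 1 else card V + 1 else 0)"

lemma sum_neighbours:
  fixes f :: "'a \<Rightarrow> nat"
  assumes "rooted v p"
  shows "(\<Sum>c\<in>V. if {v, c} \<in> E then if c = p then k else f c else 0) =
    (\<Sum>c\<in>children v p. f c) + k * of_bool ({v, p} \<in> E)" (is "?l = _")
proof -
  have "?l = (\<Sum>c\<in>{c \<in> V. {v, c} \<in> E}. if c = p then k else f c)"
    using finite_V by (simp add: sum.inter_filter)
  also have "{c \<in> V. {v, c} \<in> E} = children v p \<union> (if {v, p} \<in> E then {p} else {})"
    by (auto simp: children_def edge_sym dest: edge_in_V)
  also have "(\<Sum>c\<in>\<dots>. if c = p then k else f c) = (\<Sum>c\<in>children v p. if c = p then k else f c) +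
      (\<Sum>c\<in>(if {v, p} \<in> E then {p} else {}). if c = p then k else f c)"
    by (rule sum.union_disjoint) (use finite_children in \<open>auto simp: children_def\<close>)
  also have "(\<Sum>c\<in>children v p. if c = p then k else f c) = (\<Sum>c\<in>children v p. f c)"
    by (rule sum.cong) (auto simp: children_def)
  finally show ?thesis by simp
qed

lemma required_iff_sum:
  assumes "rooted v p"
  shows "required v p \<longleftrightarrow> 
    (\<Sum>c\<in>V. if {v, c} \<in> E then if c = p then 0 else lower_value c v else 0) + of_bool (v \<in> U) \<noteq> (0 :: nat)"
  using required_rec[OF assms]
  by (auto simp: sum_neighbours[OF assms] finite_children lower_value_def)

text \<open>Doubling replaces the halving of the degree, which the machine does not offer; the
  rounding turns into the \<open>+ 1\<close> of the upper bound.\<close>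

lemma feasible_iff_sum:
  assumes rt: "rooted v p"
  defines "d \<equiv> (\<Sum>c\<in>V. of_bool ({v, c} \<in> E)) :: nat"
  shows "feasible v p \<longleftrightarrow> v \<notin> N \<and>
    2 * (\<Sum>c\<in>V. if {v, c} \<in> E then if c = p then 1 else lower_value c v else 0) \<le> d \<and>
    d \<le> 2 * (\<Sum>c\<in>V. if {v, c} \<in> E then if c = p then 1 else upper_value c v else 0) + 1"
proof -
  let ?C = "children v p" and ?q = "of_bool ({v, p} \<in> E) :: nat"
  have d: "d = deg_in E V v" unfolding d_def deg_in_def
    using finite_V by (simp add: edge_sym Int_def)
  have dV: "d \<le> card V" unfolding d deg_in_def using finite_V by (intro card_mono) auto
  have up: "(\<Sum>c\<in>?C. upper_value c v) = card {c \<in> ?C. feasible c v}"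
    using finite_children by (simp add: upper_value_def Int_def)
  show ?thesis
  proof (cases "\<forall>c\<in>?C. required c v \<longrightarrow> feasible c v")
    case True
    have "(\<Sum>c\<in>?C. lower_value c v) = (\<Sum>c\<in>?C. of_bool (required c v))"
      using True by (intro sum.cong) (auto simp: lower_value_def)
    also have "\<dots> = card {c \<in> ?C. required c v}"
      using finite_children by (simp add: Int_def)
    finally have lo: "(\<Sum>c\<in>?C. lower_value c v) = card {c \<in> ?C. required c v}" .
    have 1: "r \<le> d div 2 \<longleftrightarrow> 2 * r \<le> d" for r by presburger
    have 2: "d div 2 \<le> r \<longleftrightarrow> d \<le> 2 * r + 1" for r by presburger
    show ?thesis
      unfolding feasible_rec[OF rt] sum_neighbours[OF rt] up lo d[symmetric] 1 2 using True by auto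
  next
    case False
    then obtain c where c: "c \<in> ?C" "lower_value c v = card V + 1" by (auto simp: lower_value_def)
    \<comment> \<open>This entry alone exceeds the degree, as \<open>d \<le> card V\<close>.\<close>
    have "lower_value c v \<le> (\<Sum>c\<in>?C. lower_value c v)"
      using c finite_children by (intro member_le_sum) auto
    then have "d < 2 * (\<Sum>c\<in>?C. lower_value c v)" using c dV by linarith
    then have "\<not> 2 * ((\<Sum>c\<in>?C. lower_value c v) + 1 * ?q) \<le> d" by (cases "{v, p} \<in> E") simp_all
    then show ?thesis
      unfolding sum_neighbours[OF rt] feasible_rec[OF rt] using False by blast
  qed
qed

end

section \<open>Memory layout and invariants of the sweeps\<close>

locale tree_instance = alliance_instance "{..<n}" E U N for n :: nat and E U N
begin

abbreviation input :: "bool list" where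
  "input \<equiv> encode n E U N"

text \<open>Each pair takes two registers, the lower value first; a row has \<open>n + 1\<close>
  pairs, the last for the root case. The offset 32 lies beyond the working registers.\<close>

definition cell :: "nat \<Rightarrow> nat \<Rightarrow> nat" where
  "cell v p = 32 + v * (2 * n + 2) + 2 * p"

text \<open>Up to offset and factor 2 the address is \<open>v * (n + 1) + p\<close> with
  \<open>p \<le> n\<close>, so division by \<open>n + 1\<close> recovers \<open>v\<close>.\<close>

lemma cell_inject:
  assumes "p \<le> n" "p' \<le> n" "cell v p = cell v' p'"
  shows "v = v' \<and> p = p'"
proof -
  have eq: "v * (n + 1) + p = v' * (n + 1) + p'"
    using assms(3) by (simp add: cell_def algebra_simps)
  have "(v * (n + 1) + p) div (n + 1) = v" "(v' * (n + 1) + p') div (n + 1) = v'"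
    using assms by (simp_all only: div_mult_self3 div_less add_0_right le_imp_less_Suc Suc_eq_plus1[symmetric] nat.distinct not_False_eq_True)
  with eq have "v = v'" by simp
  with eq show ?thesis by simp
qed

lemma cell_ne_Suc_cell: "cell v p \<noteq> Suc (cell v' p')"
proof
  assume "cell v p = Suc (cell v' p')"
  moreover have "even (cell v p)" "even (cell v' p')" by (auto simp: cell_def)
  ultimately show False by simp
qed

definition constants :: "(nat \<Rightarrow> nat) \<Rightarrow> bool" where
  "constants X \<longleftrightarrow> X 3 = 1 \<and> X 4 = n \<and> X 5 = n + 1 \<and> X 6 = 2 * n + 2 \<and>
     X 29 = n + 1 + n * n \<and> X 30 = n + 1 + n * n + n \<and> X 31 = 32"

definition at_row :: "nat \<Rightarrow> (nat \<Rightarrow> nat) \<Rightarrow> bool" where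
  "at_row v X \<longleftrightarrow> X 9 = n + 1 + v * n \<and> X 10 = 32 + 2 * v \<and> X 11 = n + 1 + n * n + v \<and>
     X 28 = n + 1 + n * n + n + v \<and> X 12 = n - v"

text \<open>
  The cells are correct for all branches of size at most \<open>k\<close>, and those preceding \<open>(v, p)\<close> in
  the current sweep also for size \<open>k + 1\<close>.
\<close>

definition table :: "nat \<Rightarrow> nat \<Rightarrow> nat \<Rightarrow> (nat \<Rightarrow> nat) \<Rightarrow> bool" where
  "table k v p X \<longleftrightarrow> (\<forall>v' p'. rooted v' p' \<and> p' \<le> n \<and>
     (card (branch v' p') \<le> k \<or> card (branch v' p') \<le> Suc k \<and> (v' < v \<or> v' = v \<and> p' < p)) \<longrightarrow>
     X (cell v' p') = lower_value v' p' \<and> X (Suc (cell v' p')) = upper_value v' p')"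

text \<open>In a branch of size at most \<open>k + 1\<close> the children have branches of size at
  most \<open>k\<close>, so the entries read are correct whether or not this sweep has rewritten
  them. About larger branches \<open>table\<close> claims nothing.\<close>

lemma achieves_cell:
  assumes X: "constants X" "at_row v X" "X 8 = cell v p" "X 13 = p" "X 14 = Suc n - p" "table k v p X"
    and v: "v < n" and p: "p \<le> n"
  shows "achieves input (scan ;; update_cell) (21 * n + 31) (\<lambda>Y. constants Y \<and> at_row v Y \<and>
     Y 8 = cell v (Suc p) \<and> Y 13 = Suc p \<and> Y 14 = Suc n - Suc p \<and> table k v (Suc p) Y \<and> Y 7 = X 7) X"
proof (rule achieves_SeqI)
  define a where "a c = (input_symbol input (X 9 + c) \<noteq> 0)" for c
  define b where "b c = X 10 + c * (2 * n + 2)" for c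
  let ?R = "\<lambda>Y. (\<forall>r. r < 15 \<or> 27 < r \<longrightarrow> Y r = X r) \<and>
     Y 19 = (\<Sum>c<n. if a c then if c = X 13 then 1 else X (b c) else 0) \<and>
     Y 20 = (\<Sum>c<n. if a c then if c = X 13 then 1 else X (b c + 1) else 0) \<and>
     Y 21 = (\<Sum>c<n. if a c then if c = X 13 then 0 else X (b c) else 0) \<and>
     Y 22 = (\<Sum>c<n. of_bool (a c))"
  show "achieves input scan (21 * n + 9) ?R X"
    using X unfolding a_def b_def
    by (intro achieves_scan) (auto simp: constants_def at_row_def)
  fix Y assume R: "?R Y"
  define req where "req \<longleftrightarrow> Y 21 + input_symbol input (Y 11) \<noteq> 0"
  define ok where "ok \<longleftrightarrow> input_symbol input (Y 28) = 0 \<and> 2 * Y 19 \<le> Y 22 \<and> Y 22 \<le> 2 * Y 20 + 1"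
  have flags: "req \<longleftrightarrow> required v p" "ok \<longleftrightarrow> feasible v p"
    if rt: "rooted v p" and le: "card (branch v p) \<le> Suc k"
  proof -
    have a: "a c \<longleftrightarrow> {v, c} \<in> E" if "c < n" for c
      using input_symbol_edge[OF v that] X(2) by (simp add: a_def at_row_def)
    \<comment> \<open>The entry read for a child \<open>c\<close> is the one in which
      \<open>v\<close> is its parent.\<close>
    have b: "X (b c) = lower_value c v" "X (b c + 1) = upper_value c v"
      if "{v, c} \<in> E" "c \<noteq> p" for c
    proof -
      have c: "c \<in> children v p" using that by (simp add: children_def edge_sym)
      then have "card (branch c v) \<le> k" using card_branch_child[OF rt] le by fastforce
      then have "X (cell c v) = lower_value c v" "X (Suc (cell c v)) = upper_value c v"
        using X(6) rooted_child[OF c] v unfolding table_def by auto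
      moreover have "b c = cell c v" using X(2) by (simp add: b_def cell_def at_row_def)
      ultimately show "X (b c) = lower_value c v" "X (b c + 1) = upper_value c v" by auto
    qed
    have "Y 19 = (\<Sum>c<n. if {v, c} \<in> E then if c = p then 1 else lower_value c v else 0)"
      using R a b X(4) by (auto intro!: sum.cong)
    moreover have "Y 20 = (\<Sum>c<n. if {v, c} \<in> E then if c = p then 1 else upper_value c v else 0)"
      using R a b X(4) by (auto intro!: sum.cong)
    moreover have 21: "Y 21 = (\<Sum>c<n. if {v, c} \<in> E then if c = p then 0 else lower_value c v else 0)"
      using R a b X(4) by (auto intro!: sum.cong)
    moreover have "Y 22 = (\<Sum>c<n. of_bool ({v, c} \<in> E))"
    proof -
      have "(\<Sum>c<n. of_bool (a c)) = (\<Sum>c<n. of_bool ({v, c} \<in> E) :: nat)"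
        by (rule sum.cong) (simp_all add: a)
      then show ?thesis using R by simp
    qed
    moreover have "input_symbol input (Y 28) = of_bool (v \<in> N)" "input_symbol input (Y 11) = of_bool (v \<in> U)"
      using R X(2) input_symbol_N[OF v, of E U N] input_symbol_U[OF v, of E U N] by (auto simp: at_row_def)
    ultimately show "req \<longleftrightarrow> required v p" "ok \<longleftrightarrow> feasible v p"
      unfolding req_def ok_def required_iff_sum[OF rt] feasible_iff_sum[OF rt] by auto
  qed
  have Y8: "Y 8 = cell v p" using R X(3) by simp
  show "achieves input update_cell 22 (\<lambda>Y. constants Y \<and> at_row v Y \<and>
     Y 8 = cell v (Suc p) \<and> Y 13 = Suc p \<and> Y 14 = Suc n - Suc p \<and> table k v (Suc p) Y \<and> Y 7 = X 7) Y"
  proof (rule achieves_weaken[OF achieves_update_cell[where n = n and w = input and X = Y,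
        folded req_def ok_def, unfolded Y8]])
    show "Y 3 = 1" "Y 5 = n + 1" using R X(1) by (auto simp: constants_def)
    show "32 \<le> cell v p" by (simp add: cell_def)
  next
    fix Z assume Z: "(\<forall>r. r \<notin> {8, 13, 14} \<and> (r < 15 \<or> 27 < r) \<and> r \<noteq> cell v p \<and> r \<noteq> cell v p + 1 \<longrightarrow> Z r = Y r) \<and>
     Z 8 = cell v p + 2 \<and> Z 13 = Suc (Y 13) \<and> Z 14 = Y 14 - 1 \<and>
     Z (cell v p) = (if req then if ok then 1 else n + 1 else 0) \<and> Z (cell v p + 1) = of_bool ok"
    have big: "32 \<le> cell v' p'" for v' p' by (simp add: cell_def)
    have ZX: "Z r = X r" if "r \<notin> {8, 13, 14}" "r < 15 \<or> 27 < r" "r \<noteq> cell v p" "r \<noteq> Suc (cell v p)" for r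
      using Z R that by simp
    have reg: "Z r = X r" if "r \<notin> {8, 13, 14}" "r < 15 \<or> 27 < r \<and> r < 32" for r
      by (rule ZX) (use that big[of v p] in auto)
    have "constants Z" "at_row v Z" "Z 7 = X 7"
      using X(1,2) reg by (auto simp: constants_def at_row_def)
    moreover have "Z 8 = cell v (Suc p)" "Z 13 = Suc p" "Z 14 = Suc n - Suc p"
      using Z R X by (auto simp: cell_def)
    moreover have "table k v (Suc p) Z"
      unfolding table_def
    proof (intro allI impI)
      fix v' p' assume c: "rooted v' p' \<and> p' \<le> n \<and>
         (card (branch v' p') \<le> k \<or> card (branch v' p') \<le> Suc k \<and> (v' < v \<or> v' = v \<and> p' < Suc p))"
      show "Z (cell v' p') = lower_value v' p' \<and> Z (Suc (cell v' p')) = upper_value v' p'"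
      proof (cases "v' = v \<and> p' = p")
        case True
        then have "rooted v p" "card (branch v p) \<le> Suc k" using c by auto
        then have "req \<longleftrightarrow> required v p" "ok \<longleftrightarrow> feasible v p" using flags by blast+
        then show ?thesis using Z True by (simp add: lower_value_def upper_value_def)
      next
        case False
        then have ne: "cell v' p' \<noteq> cell v p" using cell_inject c p by blast
        have "Z (cell v' p') = X (cell v' p')" "Z (Suc (cell v' p')) = X (Suc (cell v' p'))"
          using ne big[of v' p'] cell_ne_Suc_cell[of v p v' p'] cell_ne_Suc_cell[of v' p' v p]
          by (intro ZX; force)+
        moreover have "card (branch v' p') \<le> k \<or> card (branch v' p') \<le> Suc k \<and> (v' < v \<or> v' = v \<and> p' < p)"
          using c False by (auto simp: less_Suc_eq)
        ultimately show ?thesis using X(6) c unfolding table_def by metis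
      qed
    qed
    ultimately show "constants Z \<and> at_row v Z \<and> Z 8 = cell v (Suc p) \<and> Z 13 = Suc p \<and>
      Z 14 = Suc n - Suc p \<and> table k v (Suc p) Z \<and> Z 7 = X 7" by blast
  qed simp
qed simp

lemma achieves_row_pass:
  assumes X: "constants X" "at_row v X" "X 8 = cell v 0" "table k v 0 X" and v: "v < n"
  shows "achieves input row_pass (42 * (n + 1)^2) (\<lambda>Y. constants Y \<and> at_row (Suc v) Y \<and>
     Y 8 = cell (Suc v) 0 \<and> table k (Suc v) 0 Y \<and> Y 7 = X 7) X"
proof -
  define I where "I p Y \<longleftrightarrow> constants Y \<and> at_row v Y \<and> Y 8 = cell v p \<and> Y 13 = p \<and> Y 14 = Suc n - p \<and>
      table k v p Y \<and> Y 7 = X 7" for p Y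
  have big: "32 \<le> cell v' p'" for v' p' by (simp add: cell_def)
  \<comment> \<open>The table starts at address 32, so changes to working registers preserve
    it.\<close>
  have tbl: "table k v p Y \<Longrightarrow> \<forall>r\<ge>32. Z r = Y r \<Longrightarrow> table k v p Z" for k v p Y Z
    unfolding table_def using big le_SucI by metis
  show ?thesis
    unfolding row_pass_def
  proof (rule achieves_SeqI[where R = "I 0"])
    show "achieves input (Block [Const 13 0, Add 14 5 2]) 2 (I 0) X"
      by (rule achieves_loop_freeI)
        (use X tbl[OF X(4)] in \<open>auto simp: I_def constants_def at_row_def\<close>)
    fix Y assume "I 0 Y"
    show "achieves input (While 14 (scan ;; update_cell) ;;
        Block [Add 9 9 4, Add 10 10 3, Add 10 10 3, Add 11 11 3, Add 28 28 3, Sub 12 12 3])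
      (((n + 1) * (21 * n + 31 + 2) + 1) + 6) (\<lambda>Y. constants Y \<and> at_row (Suc v) Y \<and>
         Y 8 = cell (Suc v) 0 \<and> table k (Suc v) 0 Y \<and> Y 7 = X 7) Y"
    proof (rule achieves_SeqI[OF achieves_While[where I = I and m = "n + 1" and T = "21 * n + 31"]])
      show "I 0 Y" by fact
      fix p Z assume "p < n + 1" "I p Z"
      then show "Z 14 \<noteq> 0 \<and> achieves input (scan ;; update_cell) (21 * n + 31) (I (Suc p)) Z"
        using achieves_cell[of Z v p k] v unfolding I_def by auto
    next
      fix Z assume "I (n + 1) Z"
      then show "Z 14 = 0 \<and> I (n + 1) Z" by (simp add: I_def)
    next
      fix Z assume Z: "I (n + 1) Z"
      then have "table k v (n + 1) Z" by (simp add: I_def)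
      \<comment> \<open>Parents range up to \<open>n\<close>, so finishing row \<open>v\<close> is
        the same as standing at the start of the next row.\<close>
      then have T: "table k (Suc v) 0 Z" unfolding table_def by (auto simp: less_Suc_eq le_less)
      show "achieves input (Block [Add 9 9 4, Add 10 10 3, Add 10 10 3, Add 11 11 3, Add 28 28 3, Sub 12 12 3])
         6 (\<lambda>Y. constants Y \<and> at_row (Suc v) Y \<and>
         Y 8 = cell (Suc v) 0 \<and> table k (Suc v) 0 Y \<and> Y 7 = X 7) Z"
        by (rule achieves_loop_freeI)
          (use Z tbl[OF T] v in \<open>auto simp: I_def constants_def at_row_def cell_def\<close>)
    qed (rule order_refl)+
  \<comment> \<open>The cost \<open>2 + (n + 1) * (21 * n + 33) + 7\<close> meets the bound with
    equality at \<open>n = 0\<close>.\<close>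
  qed (simp add: algebra_simps power2_eq_square)
qed

lemma achieves_table_pass:
  assumes X: "constants X" "table k 0 0 X"
  shows "achieves input table_pass (52 * (n + 1)^3) (\<lambda>Y. constants Y \<and> table (Suc k) 0 0 Y \<and> Y 7 = X 7 - 1) X"
proof -
  define I where "I v Y \<longleftrightarrow> constants Y \<and> at_row v Y \<and> Y 8 = cell v 0 \<and> table k v 0 Y \<and> Y 7 = X 7" for v Y
  have big: "32 \<le> cell v' p'" for v' p' by (simp add: cell_def)
  have tbl: "table k v p Y \<Longrightarrow> \<forall>r\<ge>32. Z r = Y r \<Longrightarrow> table k v p Z" for k v p Y Z
    unfolding table_def using big le_SucI by metis
  show ?thesis
    unfolding table_pass_def
  proof (rule achieves_SeqI[where R = "I 0"])
    show "achieves input (Block [Add 8 31 2, Add 9 5 2, Add 10 31 2, Add 11 29 2, Add 28 30 2, Add 12 4 2])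
      6 (I 0) X"
      by (rule achieves_loop_freeI)
        (use X tbl[OF X(2)] in \<open>auto simp: I_def constants_def at_row_def cell_def\<close>)
    fix Y assume "I 0 Y"
    show "achieves input (While 12 row_pass ;; Block [Sub 7 7 3])
      ((n * (42 * (n + 1)^2 + 2) + 1) + 1) (\<lambda>Y. constants Y \<and> table (Suc k) 0 0 Y \<and> Y 7 = X 7 - 1) Y"
    proof (rule achieves_SeqI[OF achieves_While[where I = I and m = n and T = "42 * (n + 1)^2"]])
      show "I 0 Y" by fact
      fix v Z assume "v < n" "I v Z"
      then show "Z 12 \<noteq> 0 \<and> achieves input row_pass (42 * (n + 1)^2) (I (Suc v)) Z"
        using achieves_row_pass[of Z v k] unfolding I_def by (auto simp: at_row_def)
    next
      fix Z assume "I n Z"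
      then show "Z 12 = 0 \<and> I n Z" by (simp add: I_def at_row_def)
    next
      fix Z assume Z: "I n Z"
      then have "table k n 0 Z" by (simp add: I_def)
      \<comment> \<open>Rooted vertices are below \<open>n\<close>, so all branches of size up to
        \<open>k + 1\<close> are now covered.\<close>
      then have T: "table (Suc k) 0 0 Z" unfolding table_def by (auto simp: rooted_def)
      show "achieves input (Block [Sub 7 7 3]) 1
         (\<lambda>Y. constants Y \<and> table (Suc k) 0 0 Y \<and> Y 7 = X 7 - 1) Z"
        by (rule achieves_loop_freeI)
          (use Z tbl[OF T] in \<open>auto simp: I_def constants_def\<close>)
    qed (rule order_refl)+
  qed (simp add: algebra_simps power2_eq_square power3_eq_cube)
qed

lemma achieves_collect:
  assumes X: "constants X" and H: "\<And>r. r < n \<Longrightarrow> X (Suc (cell r n)) = h r"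
  shows "achieves input collect (6 * n + 6) (\<lambda>Y. Y 0 = (\<Sum>r<n. h r)) X"
proof -
  define I where "I j Y \<longleftrightarrow> (\<forall>r>27. Y r = X r) \<and> Y 3 = 1 \<and> Y 6 = 2 * n + 2 \<and>
      Y 15 = Suc (cell j n) \<and> Y 12 = n - j \<and> Y 0 = (\<Sum>r<j. h r)" for j Y
  show ?thesis
    unfolding collect_def
  proof (rule achieves_SeqI[where R = "I 0"])
    show "achieves input (Block [Const 0 0, Add 15 31 4, Add 15 15 4, Add 15 15 3, Add 12 4 2]) 5 (I 0) X"
      by (rule achieves_loop_freeI) (use X in \<open>auto simp: I_def constants_def cell_def\<close>)
    fix Y assume "I 0 Y"
    show "achieves input (While 12 (Block [Load 25 15, Add 0 0 25, Add 15 15 6, Sub 12 12 3]))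
      (6 * n + 1) (\<lambda>Y. Y 0 = (\<Sum>r<n. h r)) Y"
    proof (rule achieves_While[where I = I and m = n and T = 4])
      show "I 0 Y" by fact
      fix j Z assume j: "j < n" and Z: "I j Z"
      have "27 < Suc (cell j n)" by (simp add: cell_def)
      then have h: "Z (Suc (cell j n)) = h j"
        using Z H[OF j] by (auto simp: I_def)
      have c: "cell (Suc j) n = cell j n + (2 * n + 2)" by (simp add: cell_def)
      show "Z 12 \<noteq> 0 \<and> achieves input (Block [Load 25 15, Add 0 0 25, Add 15 15 6, Sub 12 12 3]) 4
          (I (Suc j)) Z"
      proof (intro conjI achieves_loop_freeI)
        show "Z 12 \<noteq> 0" using Z j by (simp add: I_def)
      next
        assume "Z 2 = 0"
        then show "loop_free_wp input (Block [Load 25 15, Add 0 0 25, Add 15 15 6, Sub 12 12 3])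
            (I (Suc j)) Z"
          using Z h by (auto simp: I_def c)
      qed simp
    qed (auto simp: I_def)
  qed simp
qed

lemma achieves_read_size:
  "achieves input read_size (4 * n + 3) (\<lambda>Y. Y 3 = 1 \<and> Y 4 = n) (\<lambda>_. 0)"
proof -
  define I where "I j Y \<longleftrightarrow> Y 3 = 1 \<and> Y 4 = j \<and> Y 23 = input_symbol input j" for j and Y :: "nat \<Rightarrow> nat"
  show ?thesis
    unfolding read_size_def
  proof (rule achieves_SeqI[where R = "I 0"])
    show "achieves input (Block [Const 3 1, Read 23 4]) 2 (I 0) (\<lambda>_. 0)"
      by (rule achieves_loop_freeI) (auto simp: I_def)
    fix Y assume "I 0 Y"
    show "achieves input (While 23 (Block [Add 4 4 3, Read 23 4])) (4 * n + 1) (\<lambda>Y. Y 3 = 1 \<and> Y 4 = n) Y"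
    proof (rule achieves_While[where I = I and m = n and T = 2])
      show "I 0 Y" by fact
      fix j Z assume "j < n" and Z: "I j Z"
      then have "Z 23 \<noteq> 0" using input_symbol_size(1)[of j n E U N] by (simp add: I_def)
      moreover have "achieves input (Block [Add 4 4 3, Read 23 4]) 2 (I (Suc j)) Z"
        by (rule achieves_loop_freeI) (use Z in \<open>auto simp: I_def\<close>)
      ultimately show "Z 23 \<noteq> 0 \<and> achieves input (Block [Add 4 4 3, Read 23 4]) 2 (I (Suc j)) Z" by blast
    qed (auto simp: I_def input_symbol_size)
  qed simp
qed

lemma achieves_prepare:
  assumes X: "X 3 = 1" "X 4 = n"
  shows "achieves input prepare (4 * n + 7) constants X"
proof -
  define I where "I j Y \<longleftrightarrow> Y 3 = 1 \<and> Y 4 = n \<and> Y 5 = n + 1 \<and> Y 6 = 2 * n + 2 \<and>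
     Y 29 = n + 1 + j * n \<and> Y 31 = 32 \<and> Y 7 = n - j" for j and Y :: "nat \<Rightarrow> nat"
  show ?thesis
    unfolding prepare_def
  proof (rule achieves_SeqI[where R = "I 0"])
    show "achieves input (Block [Add 5 4 3, Add 6 5 5, Const 31 32, Add 29 5 2, Add 7 4 2]) 5 (I 0) X"
      by (rule achieves_loop_freeI) (use X in \<open>auto simp: I_def\<close>)
    fix Y assume "I 0 Y"
    show "achieves input (While 7 (Block [Add 29 29 4, Sub 7 7 3]) ;; Block [Add 30 29 4])
       ((n * (2 + 2) + 1) + 1) constants Y"
    proof (rule achieves_SeqI[OF achieves_While[where I = I and m = n and T = 2]])
      show "I 0 Y" by fact
      fix j Z assume j: "j < n" and Z: "I j Z"
      show "Z 7 \<noteq> 0 \<and> achieves input (Block [Add 29 29 4, Sub 7 7 3]) 2 (I (Suc j)) Z"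
        using j Z by (intro conjI achieves_loop_freeI) (auto simp: I_def)
    next
      fix Z assume "I n Z"
      then show "Z 7 = 0 \<and> I n Z" by (simp add: I_def)
    next
      fix Z assume "I n Z"
      then show "achieves input (Block [Add 30 29 4]) 1 constants Z"
        by (intro achieves_loop_freeI) (auto simp: I_def constants_def)
    qed (rule order_refl)+
  qed simp
qed

lemma achieves_solver:
  assumes "U \<subseteq> {..<n}"
  shows "achieves input solver (80 * (n + 1)^4) (\<lambda>Y. Y 0 \<noteq> 0 \<longleftrightarrow> has_extension {..<n} E U N) (\<lambda>_. 0)"
proof -
  let ?Q = "\<lambda>Y :: nat \<Rightarrow> nat. Y 0 \<noteq> 0 \<longleftrightarrow> has_extension {..<n} E U N"
  define I where "I k Y \<longleftrightarrow> constants Y \<and> table k 0 0 Y \<and> Y 7 = n - k" for k Y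
  have fin: "finite (branch v p)" if "rooted v p" for v p
    using that finite_branch rooted_ne unfolding rooted_def by blast
  \<comment> \<open>Branches are finite and nonempty, so none has size 0 and arbitrary register
    contents satisfy the invariant.\<close>
  have empty: "table 0 0 0 X" for X
    unfolding table_def using fin branch_self by fastforce
  \<comment> \<open>The branch of a root has \<open>n\<close> vertices, hence \<open>n\<close>
    sweeps suffice.\<close>
  have full: "X (Suc (cell r n)) = upper_value r n" if "table n 0 0 X" "r < n" for X r
  proof -
    have rt: "rooted r n" using that(2) by (simp add: rooted_def)
    have "card (branch r n) \<le> card {..<n}"
      using that(2) branch_root[of r n] by simp
    then show ?thesis using that(1) rt unfolding table_def by simp
  qed
  have ext: "(\<Sum>r<n. upper_value r n) \<noteq> 0 \<longleftrightarrow> has_extension {..<n} E U N"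
    using has_extension_iff[OF assms, of n] by (auto simp: upper_value_def)
  have collect: "achieves input collect (6 * n + 6) ?Q Z" if "I n Z" for Z
    by (rule achieves_weaken[OF achieves_collect[where h = "\<lambda>r. upper_value r n"]])
      (use that full ext in \<open>auto simp: I_def\<close>)
  have loop: "achieves input (While 7 table_pass) (n * (52 * (n + 1)^3 + 2) + 1) (I n) Y" if "I 0 Y" for Y
  proof (rule achieves_While[where I = I and m = n and T = "52 * (n + 1)^3"])
    show "I 0 Y" by fact
    fix k Z assume k: "k < n" and Z: "I k Z"
    have "achieves input table_pass (52 * (n + 1)^3) (I (Suc k)) Z"
      by (rule achieves_weaken[OF achieves_table_pass[of Z k]]) (use Z in \<open>auto simp: I_def\<close>)
    then show "Z 7 \<noteq> 0 \<and> achieves input table_pass (52 * (n + 1)^3) (I (Suc k)) Z"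
      using k Z by (simp add: I_def)
  qed (auto simp: I_def)
  have init: "achieves input (Block [Add 7 4 2]) 1 (I 0) Z" if "constants Z" for Z
    using that by (intro achieves_loop_freeI) (auto simp: I_def constants_def empty)
  have bound: "(4 * n + 3) + ((4 * n + 7) + (1 + ((n * (52 * (n + 1)^3 + 2) + 1) + (6 * n + 6)))) \<le> 80 * (n + 1)^4"
    by (simp add: algebra_simps power3_eq_cube power4_eq_xxxx)
  show ?thesis
    unfolding solver_def
    by (rule achieves_SeqI[OF achieves_read_size _ bound], rule achieves_SeqI[OF achieves_prepare _ order_refl],
      simp, simp, rule achieves_SeqI[OF init _ order_refl], assumption,
      rule achieves_SeqI[OF loop _ order_refl], assumption, rule collect)
qed

end

theorem theorem3: "poly_time_solvable_on tree_instances Ext_GM_Def_Alliance"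
  unfolding poly_time_solvable_on_def
proof (intro exI ballI)
  \<comment> \<open>This is \<open>80 * (x + 1)^4\<close>, and \<open>n\<close> is at most the
    length of the word.\<close>
  let ?p = "[:80:] * [:1, 1:] ^ 4 :: nat poly"
  fix w assume "w \<in> tree_instances"
  then obtain n E U N where w: "w = encode n E U N"
    and t: "tree {..<n} E" and sub: "U \<subseteq> {..<n}" "N \<subseteq> {..<n}"
    by (auto simp: tree_instances_def)
  interpret tree_instance n E U N
    by unfold_locales (rule t)
  \<comment> \<open>Membership of \<open>w\<close> only provides some instance with this encoding;
    \<open>encode_inject\<close> identifies it with the given one.\<close>
  have "w \<in> Ext_GM_Def_Alliance \<longleftrightarrow> has_extension {..<n} E U N"
  proof
    assume "w \<in> Ext_GM_Def_Alliance"
    then obtain n' E' U' N' where w': "w = encode n' E' U' N'" "simple_graph {..<n'} E'"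
      "U' \<subseteq> {..<n'}" "N' \<subseteq> {..<n'}" "has_extension {..<n'} E' U' N'"
      unfolding Ext_GM_Def_Alliance_def by blast
    have "simple_graph {..<n} E" using t by (simp add: tree_def)
    then have "n = n' \<and> E = E' \<and> U = U' \<and> N = N'"
      using encode_inject w w' sub by metis
    then show "has_extension {..<n} E U N" using w' by simp
  next
    assume "has_extension {..<n} E U N"
    then show "w \<in> Ext_GM_Def_Alliance"
      using w t sub unfolding Ext_GM_Def_Alliance_def tree_def by blast
  qed
  moreover have "80 * (n + 1) ^ 4 \<le> poly ?p (length w)"
  proof -
    have "(n + 1) ^ 4 \<le> (length w + 1) ^ 4"
      using w by (intro power_mono) (auto simp: length_encode)
    then show ?thesis by simp
  qed
  ultimately show "halts_within (compile 0 solver) w (poly ?p (length w)) \<and>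
      (snd (run (compile 0 solver) w (poly ?p (length w))) 0 \<noteq> 0 \<longleftrightarrow> w \<in> Ext_GM_Def_Alliance)"
    using achieves_run[OF achieves_solver[OF sub(1)]] w by simp
qed

end
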